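(* Let $p\ge 5$ be prime, and suppose $\sigma=(H_1,\ldots,H_d)$ is a polynomial automorphism of $\mathbb{Z}_p[x_1,\ldots,x_d]$. Let $S$ be a commutative $\mathbb{Z}_p$-algebra that is finitely generated and torsion-free as a $\mathbb{Z}_p$-module. Suppose that $\mathbf{s}_0=(s_1,\ldots,s_d)\in S^d$ satisfies the following two conditions: (i) $H_i(s_1,\ldots,s_d)\equiv s_i \pmod{pS}$ for $1\le i\le d$; (ii) the Jacobian matrix $J(\sigma;\mathbf{x})$ evaluated at $\mathbf{x}=\mathbf{s}_0$ is congruent to the identity matrix modulo $pS$. Then there exist power series $f_1(z),\ldots,f_d(z)\in (S\otimes_{\mathbb{Z}_p}\mathbb{Q}_p)[[z]]$ which converge for all $z\in\mathbb{Z}_p$ and which satisfy: (1) $f_i(z+1)=H_i(f_1(z),\ldots,f_d(z))$ for $1\le i\le d$ (and $z\in\mathbb{Z}_p$); (2) $f_i(0)=s_i$ for $1\le i\le d$.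
   Context: Writing $\sigma=(H_1,\ldots,H_d)$ means that $\sigma$ is the $\mathbb{Z}_p$-algebra automorphism of $\mathbb{Z}_p[x_1,\ldots,x_d]$ with $\sigma(x_i)=H_i(x_1,\ldots,x_d)$. The Jacobian matrix is $J(\sigma;\mathbf{x})=\left(\partial H_i/\partial x_j\right)_{1\le i,j\le d}$; evaluating it at $\mathbf{s}_0$ means substituting $x_j=s_j$, giving a $d\times d$ matrix over $S$, and congruence modulo $pS$ is entrywise. Since $S$ is torsion-free, it is regarded as a subring of the finite-dimensional $\mathbb{Q}_p$-algebra $S\otimes_{\mathbb{Z}_p}\mathbb{Q}_p$, and convergence is with respect to the $p$-adic topology of this finite-dimensional $\mathbb{Q}_p$-vector space. *)

theory Defs
  imports
    "HOL-Algebra.Module"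
    "HOL-Computational_Algebra.Computational_Algebra"
    "HOL-Library.Multiset"
    "HOL-Library.Poly_Mapping"
    "Berlekamp_Zassenhaus.Finite_Field"
begin

section \<open>The rings of p-adic integers and p-adic numbers\<close>

text \<open>
  The prime is \<open>p = CARD('p)\<close> for a type \<open>'p\<close> of class \<^class>\<open>prime_card\<close>.  A p-adic integer is
  a compatible sequence of residues modulo \<open>p ^ n\<close>, each represented in \<open>{0..<p ^ n}\<close>, i.e. an
  element of the inverse limit of the rings of integers modulo \<open>p ^ n\<close>.
\<close>

typedef (overloaded) 'p zp =
  "{x :: nat \<Rightarrow> int. (\<forall>n. x n \<in> {0..<int CARD('p::prime_card) ^ n}) \<and>
                    (\<forall>n. x (Suc n) mod int CARD('p) ^ n = x n)}"
  morphisms zp_residue Abs_zp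
  by (rule exI[of _ "\<lambda>_. 0"]) (auto simp: prime_gt_0_nat[OF prime_card])

setup_lifting type_definition_zp

lemma CARD_power_pos: "0 < int CARD('p::prime_card) ^ n"
  using prime_gt_0_nat[OF prime_card[where 'a='p]] by simp

lemma mod_power_Suc:
  "(a mod int CARD('p::prime_card) ^ Suc n) mod int CARD('p) ^ n = a mod int CARD('p) ^ n"
  by (rule mod_mod_cancel) (simp add: le_imp_power_dvd)

instantiation zp :: (prime_card) comm_ring_1
begin

lift_definition zero_zp :: "'a zp" is "\<lambda>_. 0"
  using CARD_power_pos by auto

lift_definition one_zp :: "'a zp" is "\<lambda>n. 1 mod int CARD('a) ^ n"
  using CARD_power_pos[where 'p='a] mod_power_Suc[where 'p='a]
  by (auto simp del: power_Suc)

lift_definition plus_zp :: "'a zp \<Rightarrow> 'a zp \<Rightarrow> 'a zp" is "\<lambda>x y n. (x n + y n) mod int CARD('a) ^ n"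
  using CARD_power_pos[where 'p='a] 
  by (auto simp del: power_Suc simp: mod_power_Suc) (metis mod_add_eq)

lift_definition uminus_zp :: "'a zp \<Rightarrow> 'a zp" is "\<lambda>x n. (- x n) mod int CARD('a) ^ n"
  using CARD_power_pos[where 'p='a] 
  by (auto simp del: power_Suc simp: mod_power_Suc) (metis mod_minus_eq)

lift_definition minus_zp :: "'a zp \<Rightarrow> 'a zp \<Rightarrow> 'a zp" is "\<lambda>x y n. (x n - y n) mod int CARD('a) ^ n"
  using CARD_power_pos[where 'p='a] 
  by (auto simp del: power_Suc simp: mod_power_Suc) (metis mod_diff_eq)

lift_definition times_zp :: "'a zp \<Rightarrow> 'a zp \<Rightarrow> 'a zp" is "\<lambda>x y n. (x n * y n) mod int CARD('a) ^ n"
  using CARD_power_pos[where 'p='a] 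
  by (auto simp del: power_Suc simp: mod_power_Suc) (metis mod_mult_eq)

instance
proof
  fix a b c :: "'a zp"
  show "a * b * c = a * (b * c)"
    by transfer (auto simp: fun_eq_iff mod_simps algebra_simps)
  show "a * b = b * a"
    by transfer (auto simp: fun_eq_iff algebra_simps)
  show "a + b + c = a + (b + c)"
    by transfer (auto simp: fun_eq_iff mod_simps algebra_simps)
  show "a + b = b + a"
    by transfer (auto simp: fun_eq_iff algebra_simps)
  show "0 + a = a" by transfer (auto simp: fun_eq_iff)
  show "1 * a = a" by transfer (auto simp: fun_eq_iff mod_simps)
  show "- a + a = 0"
    by transfer (auto simp: fun_eq_iff mod_simps)
  show "a - b = a + - b"
    by transfer (auto simp: fun_eq_iff mod_simps)
  show "(a + b) * c = a * c + b * c"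
    by transfer (auto simp: fun_eq_iff mod_simps algebra_simps)
  have "zp_residue (0 :: 'a zp) 1 \<noteq> zp_residue (1 :: 'a zp) 1"
    using prime_gt_1_nat[OF prime_card[where 'a='a]] by transfer auto
  then show "(0 :: 'a zp) \<noteq> 1" by auto
qed

end

lemma zp_residue_mod_power:
  "zp_residue (x :: 'p::prime_card zp) (n + k) mod int CARD('p) ^ n = zp_residue x n"
proof (induction k)
  case 0
  show ?case using zp_residue[of x] by (auto intro: mod_pos_pos_trivial)
next
  case (Suc k)
  have "zp_residue x (n + Suc k) mod int CARD('p) ^ (n + k) = zp_residue x (n + k)"
    using zp_residue[of x] by auto
  then show ?case
    using Suc mod_mod_cancel[of "int CARD('p) ^ n" "int CARD('p) ^ (n + k)" "zp_residue x (n + Suc k)"]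
    by (simp add: le_imp_power_dvd)
qed

instance zp :: (prime_card) idom
proof
  fix x y :: "'a zp"
  assume "x \<noteq> 0" "y \<noteq> 0"
  let ?p = "int CARD('a)"
  have p: "prime ?p" using prime_card[where 'a='a] by simp
  obtain n where n: "zp_residue x n \<noteq> 0"
    using \<open>x \<noteq> 0\<close> by (auto simp: zp_residue_inject[symmetric] zero_zp.rep_eq fun_eq_iff)
  obtain m where m: "zp_residue y m \<noteq> 0"
    using \<open>y \<noteq> 0\<close> by (auto simp: zp_residue_inject[symmetric] zero_zp.rep_eq fun_eq_iff)
  let ?a = "zp_residue x (n + m)" and ?b = "zp_residue y (n + m)"
  have a: "\<not> ?p ^ n dvd ?a"
    using zp_residue_mod_power[of x n m] n by (auto simp: dvd_eq_mod_eq_0)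
  have b: "\<not> ?p ^ m dvd ?b"
    using zp_residue_mod_power[of y m n] m by (auto simp: dvd_eq_mod_eq_0 add.commute)
  have [simp]: "?a \<noteq> 0" "?b \<noteq> 0" using a b by auto
  have "multiplicity ?p ?a < n" "multiplicity ?p ?b < m"
    using a b p by (auto intro!: multiplicity_lessI)
  then have "\<not> ?p ^ (n + m) dvd ?a * ?b"
    using p by (subst power_dvd_iff_le_multiplicity)
      (auto simp: prime_elem_multiplicity_mult_distrib)
  then have "zp_residue (x * y) (n + m) \<noteq> 0"
    by (simp add: times_zp.rep_eq dvd_eq_mod_eq_0)
  then show "x * y \<noteq> 0" by (auto simp: zero_zp.rep_eq)
qed

type_synonym 'p qp = "'p zp fract"


section \<open>Polynomials in finitely many variables\<close>

text \<open>The variables are indexed by the finite type \<open>'d\<close>, so that \<open>d = CARD('d)\<close>.\<close>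

type_synonym ('d, 'a) mpoly = "('d \<Rightarrow>\<^sub>0 nat) \<Rightarrow>\<^sub>0 'a"

definition mpoly_const :: "'a \<Rightarrow> ('d, 'a::zero) mpoly" where
  "mpoly_const c = Poly_Mapping.single 0 c"

definition mpoly_var :: "'d \<Rightarrow> ('d, 'a::zero_neq_one) mpoly" where
  "mpoly_var i = Poly_Mapping.single (Poly_Mapping.single i 1) 1"

text \<open>
  For a monomial not containing the variable \<open>j\<close> the truncated subtraction in the exponent is
  harmless, as the coefficient \<open>of_nat 0\<close> vanishes.
\<close>

definition mpoly_partial :: "'d \<Rightarrow> ('d, 'a::comm_ring_1) mpoly \<Rightarrow> ('d, 'a) mpoly" where
  "mpoly_partial j P =
     (\<Sum>m\<in>Poly_Mapping.keys P.
        Poly_Mapping.single (m - Poly_Mapping.single j 1)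
          (of_nat (Poly_Mapping.lookup m j) * Poly_Mapping.lookup P m))"

definition mpoly_algebra_automorphism ::
    "(('d, 'a::comm_ring_1) mpoly \<Rightarrow> ('d, 'a) mpoly) \<Rightarrow> bool" where
  "mpoly_algebra_automorphism \<sigma> \<longleftrightarrow>
     bij \<sigma> \<and>
     (\<forall>P Q. \<sigma> (P + Q) = \<sigma> P + \<sigma> Q) \<and>
     (\<forall>P Q. \<sigma> (P * Q) = \<sigma> P * \<sigma> Q) \<and>
     (\<forall>c. \<sigma> (mpoly_const c) = mpoly_const c)"


section \<open>Algebras over the p-adic integers\<close>

text \<open>
  The sort \<open>{comm_ring, comm_monoid_mult}\<close> is that of commutative rings with identity in which
  \<open>0 = 1\<close> is not excluded, so that the zero algebra is covered as well.  The locale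
  \<open>Modules.module\<close> is the one from HOL, not its namesake in HOL-Algebra.
\<close>

locale zp_algebra = Modules.module scale
  for scale :: "'p::prime_card zp \<Rightarrow> 's \<Rightarrow> 's::{comm_ring, comm_monoid_mult}" +
  assumes scale_mult_left: "scale a x * y = scale a (x * y)"

definition finitely_generated_module :: "('a::comm_ring_1 \<Rightarrow> 's \<Rightarrow> 's::ab_group_add) \<Rightarrow> bool" where
  "finitely_generated_module scale \<longleftrightarrow> (\<exists>G. finite G \<and> Modules.module.span scale G = UNIV)"

definition torsion_free_module :: "('a::idom \<Rightarrow> 's \<Rightarrow> 's::ab_group_add) \<Rightarrow> bool" where
  "torsion_free_module scale \<longleftrightarrow> (\<forall>a x. scale a x = 0 \<longrightarrow> a = 0 \<or> x = 0)"

definition cong_p :: "('p::prime_card zp \<Rightarrow> 's \<Rightarrow> 's::ab_group_add) \<Rightarrow> 's \<Rightarrow> 's \<Rightarrow> bool" where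
  "cong_p scale x y \<longleftrightarrow> x - y \<in> range (scale (of_nat CARD('p)))"

definition mpoly_eval ::
    "('a::zero \<Rightarrow> 's \<Rightarrow> 's::{comm_ring, comm_monoid_mult}) \<Rightarrow> ('d::finite \<Rightarrow> 's) \<Rightarrow> ('d, 'a) mpoly \<Rightarrow> 's" where
  "mpoly_eval scale x P =
     (\<Sum>m\<in>Poly_Mapping.keys P.
        scale (Poly_Mapping.lookup P m) (\<Prod>i\<in>UNIV. x i ^ Poly_Mapping.lookup m i))"


section \<open>Base change to the p-adic numbers\<close>

text \<open>
  The tensor product of \<open>S\<close> with the p-adic numbers over the p-adic integers.  A finite formal sum
  of pure tensors \<open>s \<otimes> q\<close> is a multiset of pairs \<open>(s, q)\<close>, and \<open>tensor_rel\<close> is the congruence on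
  formal sums generated by bilinearity and by \<open>a s \<otimes> q = s \<otimes> a q\<close>.  Formal sums only form a
  monoid, which is why \<open>0 \<otimes> q = 0\<close> is imposed separately.
\<close>

inductive tensor_rel ::
    "('p::prime_card zp \<Rightarrow> 's \<Rightarrow> 's::ab_group_add) \<Rightarrow>
     ('s \<times> 'p qp) multiset \<Rightarrow> ('s \<times> 'p qp) multiset \<Rightarrow> bool"
  for scale where
  refl: "tensor_rel scale X X"
| sym: "tensor_rel scale X Y \<Longrightarrow> tensor_rel scale Y X"
| trans: "tensor_rel scale X Y \<Longrightarrow> tensor_rel scale Y Z \<Longrightarrow> tensor_rel scale X Z"
| sum: "tensor_rel scale X X' \<Longrightarrow> tensor_rel scale Y Y' \<Longrightarrow> tensor_rel scale (X + Y) (X' + Y')"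
| zero: "tensor_rel scale {#(0, q)#} {#}"
| add_left: "tensor_rel scale {#(s + t, q)#} {#(s, q), (t, q)#}"
| add_right: "tensor_rel scale {#(s, q + r)#} {#(s, q), (s, r)#}"
| balanced: "tensor_rel scale {#(scale a s, q)#} {#(s, to_fract a * q)#}"

definition tensor_class ::
    "('p::prime_card zp \<Rightarrow> 's \<Rightarrow> 's::ab_group_add) \<Rightarrow> ('s \<times> 'p qp) multiset \<Rightarrow> ('s \<times> 'p qp) multiset set" where
  "tensor_class scale X = {Y. tensor_rel scale X Y}"

text \<open>The bilinear extensions of \<open>(s \<otimes> q) (t \<otimes> r) = st \<otimes> qr\<close> and \<open>q (s \<otimes> r) = s \<otimes> qr\<close>.\<close>

definition formal_mult ::
    "('s::times \<times> 'q::times) multiset \<Rightarrow> ('s \<times> 'q) multiset \<Rightarrow> ('s \<times> 'q) multiset" where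
  "formal_mult X Y = (\<Sum>(s, q)\<in>#X. image_mset (\<lambda>(t, r). (s * t, q * r)) Y)"

definition formal_smult :: "'q::times \<Rightarrow> ('s \<times> 'q) multiset \<Rightarrow> ('s \<times> 'q) multiset" where
  "formal_smult q X = image_mset (\<lambda>(s, r). (s, q * r)) X"

definition base_change ::
    "('p::prime_card zp \<Rightarrow> 's \<Rightarrow> 's::{comm_ring, comm_monoid_mult}) \<Rightarrow>
     ('p qp, ('s \<times> 'p qp) multiset set) module" where
  "base_change scale =
     \<lparr>carrier = range (tensor_class scale),
      mult = (\<lambda>A B. \<Union>X\<in>A. \<Union>Y\<in>B. tensor_class scale (formal_mult X Y)),
      one = tensor_class scale {#(1, 1)#},
      zero = tensor_class scale {#},
      add = (\<lambda>A B. \<Union>X\<in>A. \<Union>Y\<in>B. tensor_class scale (X + Y)),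
      smult = (\<lambda>q A. \<Union>X\<in>A. tensor_class scale (formal_smult q X))\<rparr>"

context zp_algebra
begin

lemma tensor_class_eq_iff: "tensor_class scale X = tensor_class scale Y \<longleftrightarrow> tensor_rel scale X Y"
  unfolding tensor_class_def
  by (auto intro: tensor_rel.sym tensor_rel.trans tensor_rel.refl)

lemma tensor_class_self: "X \<in> tensor_class scale X"
  by (simp add: tensor_class_def tensor_rel.refl)

lemma Union_tensor_class:
  assumes "\<And>X'. tensor_rel scale X X' \<Longrightarrow> tensor_rel scale (G X) (G X')"
  shows "(\<Union>X'\<in>tensor_class scale X. tensor_class scale (G X')) = tensor_class scale (G X)"
proof -
  have "tensor_class scale (G X') = tensor_class scale (G X)" if "X' \<in> tensor_class scale X" for X'
    using assms[of X'] that unfolding tensor_class_eq_iff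
    by (simp add: tensor_class_def tensor_rel.sym)
  then show ?thesis using tensor_class_self[of X] by blast
qed

lemma formal_mult_empty [simp]: "formal_mult {#} Y = {#}" "formal_mult X {#} = {#}"
  by (auto simp: formal_mult_def case_prod_unfold)

lemma formal_mult_add_left: "formal_mult (X + X') Y = formal_mult X Y + formal_mult X' Y"
  by (simp add: formal_mult_def)

lemma formal_mult_add_right: "formal_mult X (Y + Y') = formal_mult X Y + formal_mult X Y'"
  by (simp add: formal_mult_def case_prod_unfold sum_mset.distrib)

lemma formal_mult_single [simp]: "formal_mult {#(a, b)#} {#(c, d)#} = {#(a * c, b * d)#}"
  by (simp add: formal_mult_def)

lemma formal_mult_add_mset [simp]:
  "formal_mult (add_mset (s, q) X) Y = image_mset (\<lambda>(t, r). (s * t, q * r)) Y + formal_mult X Y"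
  by (simp add: formal_mult_def)

lemma formal_mult_commute:
  "formal_mult X Y = formal_mult Y (X :: ('s \<times> 'p qp) multiset)"
proof (induction X)
  case (add x X)
  have "formal_mult {#x#} Y = formal_mult Y {#x#}"
  proof (induction Y)
    case (add y Y)
    then show ?case
      using formal_mult_add_right[of "{#x#}" "{#y#}" Y] formal_mult_add_left[of "{#y#}" Y "{#x#}"]
      by (cases x; cases y) (simp add: mult.commute)
  qed simp
  then show ?case
    using add formal_mult_add_left[of "{#x#}" X Y] formal_mult_add_right[of Y "{#x#}" X] by simp
qed simp

lemma formal_mult_assoc:
  "formal_mult (formal_mult X Y) Z = formal_mult X (formal_mult Y (Z :: ('s \<times> 'p qp) multiset))"
proof (induction X)
  case (add x X)
  have "formal_mult (formal_mult {#x#} Y) Z = formal_mult {#x#} (formal_mult Y Z)"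
  proof (induction Y)
    case (add y Y)
    have "formal_mult (formal_mult {#x#} {#y#}) Z = formal_mult {#x#} (formal_mult {#y#} Z)"
    proof (induction Z)
      case (add z Z)
      then show ?case
        by (cases x; cases y; cases z) (simp add: mult.assoc)
    qed simp
    then show ?case
      using add formal_mult_add_right[of "{#x#}" "{#y#}" Y] formal_mult_add_left[of "{#y#}" Y Z]
      by (simp add: formal_mult_add_left formal_mult_add_right)
  qed simp
  then show ?case
    using add formal_mult_add_left[of "{#x#}" X] by (simp add: formal_mult_add_left)
qed simp

lemma formal_mult_one: "formal_mult {#(1, 1)#} X = (X :: ('s \<times> 'p qp) multiset)"
  by (simp add: formal_mult_def case_prod_unfold)

lemma tensor_rel_formal_mult_left:
  "tensor_rel scale X X' \<Longrightarrow> tensor_rel scale (formal_mult X Y) (formal_mult X' Y)"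
proof (induction Y)
  case empty
  show ?case by (simp add: tensor_rel.refl)
next
  case (add y Y)
  obtain t r where y: "y = (t, r)" by (cases y)
  have "tensor_rel scale (formal_mult X {#y#}) (formal_mult X' {#y#})"
    using add.prems
  proof (induction rule: tensor_rel.induct)
    case (sum X X' Y Y')
    then show ?case by (simp add: formal_mult_add_left tensor_rel.sum)
  next
    case (zero q)
    show ?case by (simp add: y tensor_rel.zero)
  next
    case (add_left s t' q)
    show ?case
      using tensor_rel.add_left[of scale "s * t" "t' * t" "q * r"]
      by (simp add: y distrib_right add_mset_commute)
  next
    case (add_right s q r')
    show ?case
      using tensor_rel.add_right[of scale "s * t" "q * r" "r' * r"]
      by (simp add: y distrib_right add_mset_commute)
  next
    case (balanced a s q)
    show ?case
      using tensor_rel.balanced[of scale a "s * t" "q * r"]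
      by (simp add: y scale_mult_left mult.assoc)
  next
    case (refl X)
    show ?case by (rule tensor_rel.refl)
  next
    case (sym X Y)
    then show ?case by (blast intro: tensor_rel.sym)
  next
    case (trans X Y Z)
    then show ?case by (blast intro: tensor_rel.trans)
  qed
  then show ?case
    using add formal_mult_add_right[of _ "{#y#}" Y] by (simp add: tensor_rel.sum)
qed

lemma tensor_rel_formal_mult_right:
  "tensor_rel scale Y Y' \<Longrightarrow> tensor_rel scale (formal_mult X Y) (formal_mult X Y')"
  by (subst (1 2) formal_mult_commute) (rule tensor_rel_formal_mult_left)

lemma formal_smult_eq: "formal_smult q X = formal_mult {#(1, q)#} (X :: ('s \<times> 'p qp) multiset)"
  by (simp add: formal_smult_def formal_mult_def case_prod_unfold)

lemma base_change_add:
  "tensor_class scale X \<oplus>\<^bsub>base_change scale\<^esub> tensor_class scale Y = tensor_class scale (X + Y)"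
proof -
  have "(\<Union>Y'\<in>tensor_class scale Y. tensor_class scale (X' + Y')) = tensor_class scale (X' + Y)" for X'
    by (rule Union_tensor_class) (rule tensor_rel.sum[OF tensor_rel.refl])
  moreover have "(\<Union>X'\<in>tensor_class scale X. tensor_class scale (X' + Y)) = tensor_class scale (X + Y)"
    by (rule Union_tensor_class) (rule tensor_rel.sum[OF _ tensor_rel.refl])
  ultimately show ?thesis by (simp add: base_change_def)
qed

lemma base_change_mult:
  "tensor_class scale X \<otimes>\<^bsub>base_change scale\<^esub> tensor_class scale Y = tensor_class scale (formal_mult X Y)"
proof -
  have "(\<Union>Y'\<in>tensor_class scale Y. tensor_class scale (formal_mult X' Y')) =
      tensor_class scale (formal_mult X' Y)" for X'
    by (rule Union_tensor_class) (rule tensor_rel_formal_mult_right)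
  moreover have "(\<Union>X'\<in>tensor_class scale X. tensor_class scale (formal_mult X' Y)) =
      tensor_class scale (formal_mult X Y)"
    by (rule Union_tensor_class) (rule tensor_rel_formal_mult_left)
  ultimately show ?thesis by (simp add: base_change_def)
qed

lemma base_change_smult:
  "q \<odot>\<^bsub>base_change scale\<^esub> tensor_class scale X = tensor_class scale (formal_smult q X)"
proof -
  have "(\<Union>X'\<in>tensor_class scale X. tensor_class scale (formal_smult q X')) =
      tensor_class scale (formal_smult q X)"
    by (rule Union_tensor_class) (unfold formal_smult_eq, rule tensor_rel_formal_mult_right)
  then show ?thesis by (simp add: base_change_def)
qed

lemma tensor_rel_uminus: "tensor_rel scale (image_mset (\<lambda>(s, q). (- s, q)) X + X) {#}"
proof (induction X)
  case empty
  show ?case by (simp add: tensor_rel.refl)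
next
  case (add x X)
  obtain s q where x: "x = (s, q)" by (cases x)
  have "tensor_rel scale {#(- s, q), (s, q)#} {#}"
    using tensor_rel.trans[OF tensor_rel.sym[OF tensor_rel.add_left[of scale "- s" s q]]]
      tensor_rel.zero[of scale q]
    by simp
  from tensor_rel.sum[OF this add] show ?case
    by (simp add: x add_mset_commute)
qed

lemma carrier_base_change: "carrier (base_change scale) = range (tensor_class scale)"
  and zero_base_change: "\<zero>\<^bsub>base_change scale\<^esub> = tensor_class scale {#}"
  and one_base_change: "\<one>\<^bsub>base_change scale\<^esub> = tensor_class scale {#(1, 1)#}"
  by (simp_all add: base_change_def)

theorem cring_base_change: "cring (base_change scale)"
proof (rule cringI)
  show "abelian_group (base_change scale)"
  proof (rule abelian_groupI)
    fix x assume "x \<in> carrier (base_change scale)"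
    then obtain X where "x = tensor_class scale X" by (auto simp: carrier_base_change)
    then show "\<exists>y\<in>carrier (base_change scale). y \<oplus>\<^bsub>base_change scale\<^esub> x = \<zero>\<^bsub>base_change scale\<^esub>"
      using tensor_rel_uminus[of X]
      by (auto simp: carrier_base_change base_change_add zero_base_change tensor_class_eq_iff)
  qed (auto simp: carrier_base_change base_change_add zero_base_change add_ac)
  show "comm_monoid (base_change scale)"
  proof (rule comm_monoidI)
    fix x y assume "x \<in> carrier (base_change scale)" "y \<in> carrier (base_change scale)"
    then show "x \<otimes>\<^bsub>base_change scale\<^esub> y = y \<otimes>\<^bsub>base_change scale\<^esub> x"
      by (auto simp: carrier_base_change base_change_mult simp del: formal_mult_add_mset)
        (simp_all only: formal_mult_commute)
  qed (auto simp: carrier_base_change base_change_mult one_base_change formal_mult_assoc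
      simp del: formal_mult_add_mset simp: formal_mult_one)
qed (auto simp: carrier_base_change base_change_add base_change_mult formal_mult_add_left)

end

definition base_change_embed ::
    "('p::prime_card zp \<Rightarrow> 's \<Rightarrow> 's::ab_group_add) \<Rightarrow> 's \<Rightarrow> ('s \<times> 'p qp) multiset set" where
  "base_change_embed scale s = tensor_class scale {#(s, 1)#}"

definition base_change_eval ::
    "('p::prime_card zp \<Rightarrow> 's \<Rightarrow> 's::{comm_ring, comm_monoid_mult}) \<Rightarrow>
     ('d::finite \<Rightarrow> ('s \<times> 'p qp) multiset set) \<Rightarrow> ('d, 'p zp) mpoly \<Rightarrow> ('s \<times> 'p qp) multiset set" where
  "base_change_eval scale v P =
     (\<Oplus>\<^bsub>base_change scale\<^esub> m\<in>Poly_Mapping.keys P.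
        to_fract (Poly_Mapping.lookup P m) \<odot>\<^bsub>base_change scale\<^esub>
          (\<Otimes>\<^bsub>base_change scale\<^esub> i\<in>UNIV. v i [^]\<^bsub>base_change scale\<^esub> Poly_Mapping.lookup m i))"

text \<open>
  Convergence in the p-adic topology of the base change: the sets \<open>p ^ k S\<close> form a neighbourhood
  basis of zero.  As \<open>S\<close> is finitely generated and torsion-free it is a full lattice in the base
  change, so this is its topology as a finite-dimensional vector space over the p-adic numbers.
\<close>

definition base_change_tendsto ::
    "('p::prime_card zp \<Rightarrow> 's \<Rightarrow> 's::{comm_ring, comm_monoid_mult}) \<Rightarrow>
     (nat \<Rightarrow> ('s \<times> 'p qp) multiset set) \<Rightarrow> ('s \<times> 'p qp) multiset set \<Rightarrow> bool" where
  "base_change_tendsto scale X L \<longleftrightarrow>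
     (\<forall>k. \<forall>\<^sub>F n in sequentially.
        X n \<ominus>\<^bsub>base_change scale\<^esub> L \<in> base_change_embed scale ` range (scale (of_nat CARD('p) ^ k)))"

definition power_series_sums ::
    "('p::prime_card zp \<Rightarrow> 's \<Rightarrow> 's::{comm_ring, comm_monoid_mult}) \<Rightarrow>
     ('s \<times> 'p qp) multiset set fps \<Rightarrow> 'p zp \<Rightarrow> ('s \<times> 'p qp) multiset set \<Rightarrow> bool" where
  "power_series_sums scale f z L \<longleftrightarrow>
     L \<in> carrier (base_change scale) \<and>
     base_change_tendsto scale
       (\<lambda>N. \<Oplus>\<^bsub>base_change scale\<^esub> n\<in>{..<N}. to_fract z ^ n \<odot>\<^bsub>base_change scale\<^esub> fps_nth f n) L"

end

theory Submission
  imports Defs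
begin

text \<open>
  The functions are obtained by p-adic interpolation of the forward orbit
  \<open>x (n + 1) = (H_1 (x n), \<dots>, H_d (x n))\<close> of \<open>x 0 = s\<close> by Newton series
  \<open>(\<Sum>k. (z choose k) a k)\<close>, where \<open>a k\<close> is the \<open>k\<close>-th iterated difference of the orbit at \<open>0\<close>.
  Such a series is a power series convergent on the p-adic integers if \<open>a k / fact k\<close> tends to zero fast
  enough, so the matter is to show that \<open>a k\<close> is highly divisible by \<open>p\<close>.

  Put \<open>u = x - s\<close>.  In the ring of sequences in \<open>S\<close>, give the constant \<open>p\<close> weight \<open>2\<close> and each
  component of \<open>u\<close> weight \<open>1\<close>.  By the two congruence hypotheses and Taylor's formula, the difference
  \<open>\<Delta>u\<close> has weight \<open>2\<close> (lemma \<open>fdiff_orbit_weight\<close>).  The Leibniz rule for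
  differences then shows that \<open>\<Delta>\<close> raises the weight of every sequence by one (lemma
  \<open>weight_fdiff\<close>), whence \<open>\<Delta>^k u\<close> has weight \<open>k + 1\<close>.  As \<open>u\<close> vanishes at \<open>0\<close>, the
  value of \<open>\<Delta>^k u\<close> there is divisible by \<open>p\<close> at least \<open>(k + 1) / 2\<close> times (lemma
  \<open>weight_at_0\<close>).  On the other hand \<open>fact k\<close> is divisible by \<open>p\<close> at most
  \<open>k / (p - 1) \<le> k / 4\<close> times, since \<open>p \<ge> 5\<close>.

  Consequently \<open>a k / fact k\<close> is not only small but even lies in \<open>S\<close>, and so do the coefficients of the power
  series and its values (lemma \<open>newton_series_is_power_series\<close>).  Hence the power series are constructed
  over \<open>S\<close> and then carried over to the base change by the embedding.  What is needed of \<open>S\<close> is that its p-adic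
  topology is complete and separated; the latter follows from the fact that \<open>S\<close> is a free module (lemma
  \<open>torsion_free_imp_free\<close>).  The functional equation holds at natural numbers by construction of the orbit, and
  extends to all p-adic integers by continuity and density.
\<close>

section \<open>The p-adic integers\<close>

lemma zp_residue_add: "zp_residue (x + y) n = (zp_residue x n + zp_residue y n) mod int CARD('p) ^ n"
  and zp_residue_diff: "zp_residue (x - y) n = (zp_residue x n - zp_residue y n) mod int CARD('p) ^ n"
  and zp_residue_mult: "zp_residue (x * y) n = (zp_residue x n * zp_residue y n) mod int CARD('p) ^ n"
  for x y :: "'p::prime_card zp"
  by (simp_all add: plus_zp.rep_eq minus_zp.rep_eq times_zp.rep_eq)

lemma zp_residue_range: "0 \<le> zp_residue (x :: 'p::prime_card zp) n" "zp_residue x n < int CARD('p) ^ n"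
  using zp_residue[of x] by auto

lemma zp_residue_of_nat: "zp_residue (of_nat k :: 'p::prime_card zp) n = int k mod int CARD('p) ^ n"
proof (induction k)
  case 0
  show ?case by (simp add: zero_zp.rep_eq)
next
  case (Suc k)
  then show ?case by (simp add: zp_residue_add one_zp.rep_eq mod_simps)
qed

lemma zp_residue_of_int: "zp_residue (of_int k :: 'p::prime_card zp) n = k mod int CARD('p) ^ n"
  by (cases k rule: int_diff_cases) (simp add: zp_residue_diff zp_residue_of_nat mod_simps)

lemma zp_residue_Suc: "zp_residue (x :: 'p::prime_card zp) (Suc n) mod int CARD('p) ^ n = zp_residue x n"
  using zp_residue[of x] by auto

text \<open>
  The residue modulo \<open>p ^ m\<close> is the only obstruction to divisibility: when it vanishes, every later
  residue is a multiple of \<open>p ^ m\<close>, and the quotients, shifted down by \<open>m\<close> places, are again a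
  compatible sequence.  All topological properties below go through this criterion.
\<close>

lemma power_dvd_iff_zp_residue:
  fixes x :: "'p::prime_card zp"
  shows "of_nat CARD('p) ^ m dvd x \<longleftrightarrow> zp_residue x m = 0"
proof
  assume "of_nat CARD('p) ^ m dvd x"
  then obtain y where "x = of_nat (CARD('p) ^ m) * y" by auto
  then show "zp_residue x m = 0"
    by (simp only: zp_residue_mult zp_residue_of_nat) simp
next
  assume x: "zp_residue x m = 0"
  define q where "q n = zp_residue x (m + n) div int CARD('p) ^ m" for n
  have q: "zp_residue x (m + n) = int CARD('p) ^ m * q n" for n
    using mult_div_mod_eq[of "int CARD('p) ^ m" "zp_residue x (m + n)"]
    unfolding q_def zp_residue_mod_power x by simp
  have pos: "int CARD('p) ^ m > 0" by (rule CARD_power_pos)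
  have "0 \<le> q n" "q n < int CARD('p) ^ n" for n
    using zp_residue_range[of x "m + n"] pos unfolding q
    by (simp_all add: zero_le_mult_iff power_add)
  moreover have "q (Suc n) mod int CARD('p) ^ n = q n" for n
  proof -
    have "int CARD('p) ^ m * (q (Suc n) mod int CARD('p) ^ n) =
        zp_residue x (m + Suc n) mod int CARD('p) ^ (m + n)"
      by (simp only: q power_add mult_mod_right)
    also have "\<dots> = int CARD('p) ^ m * q n"
      by (simp only: q[symmetric] add_Suc_right zp_residue_Suc)
    finally show ?thesis using pos by simp
  qed
  ultimately have res: "zp_residue (Abs_zp q :: 'p zp) = q"
    by (subst Abs_zp_inverse) auto
  have pow: "zp_residue (of_nat (CARD('p) ^ m) :: 'p zp) n = int CARD('p) ^ m mod int CARD('p) ^ n" for n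
    using zp_residue_of_nat[of "CARD('p) ^ m" n, where 'p='p] by simp
  have "x = of_nat (CARD('p) ^ m) * Abs_zp q"
  proof (subst zp_residue_inject[symmetric], rule ext)
    fix n
    have "zp_residue (of_nat (CARD('p) ^ m) * (Abs_zp q :: 'p zp)) n = zp_residue x (n + m) mod int CARD('p) ^ n"
      by (simp only: zp_residue_mult pow res mod_mult_left_eq q add.commute[of n])
    then show "zp_residue x n = zp_residue (of_nat (CARD('p) ^ m) * (Abs_zp q :: 'p zp)) n"
      by (simp only: zp_residue_mod_power)
  qed
  then show "of_nat CARD('p) ^ m dvd x" by simp
qed

lemma power_dvd_diff_iff_zp_residue:
  "of_nat CARD('p) ^ m dvd x - y \<longleftrightarrow> zp_residue x m = zp_residue (y :: 'p::prime_card zp) m"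
  using mod_eq_dvd_iff[of "zp_residue x m" "int CARD('p) ^ m" "zp_residue y m"]
    zp_residue_range[of x m] zp_residue_range[of y m]
  by (simp add: power_dvd_iff_zp_residue zp_residue_diff mod_eq_0_iff_dvd)

lemma zp_separated:
  fixes x :: "'p::prime_card zp"
  assumes "\<And>m. of_nat CARD('p) ^ m dvd x"
  shows "x = 0"
  using assms unfolding power_dvd_iff_zp_residue
  by (simp add: zp_residue_inject[symmetric] zero_zp.rep_eq fun_eq_iff)

lemma of_nat_CARD_neq_0: "of_nat CARD('p) \<noteq> (0 :: 'p::prime_card zp)"
proof
  assume "of_nat CARD('p) = (0 :: 'p zp)"
  then have "zp_residue (of_nat CARD('p) :: 'p zp) 2 = 0" by (simp add: zero_zp.rep_eq)
  moreover have "int CARD('p) < int CARD('p) ^ 2"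
    using prime_gt_1_nat[OF prime_card[where 'a='p]] by (simp add: power2_eq_square)
  ultimately show False
    by (simp add: zp_residue_of_nat)
qed

lemma of_nat_dense_zp: "\<exists>n. of_nat CARD('p) ^ m dvd (z :: 'p::prime_card zp) - of_nat n"
  using zp_residue_range[of z m]
  by (intro exI[of _ "nat (zp_residue z m)"]) (simp add: power_dvd_diff_iff_zp_residue zp_residue_of_int)

text \<open>
  The \<open>m\<close>-th residue of the sum is read off from the \<open>m\<close>-th partial sum, since the later terms
  are divisible by \<open>p ^ m\<close>.
\<close>

lemma zp_complete:
  fixes t :: "nat \<Rightarrow> 'p::prime_card zp"
  shows "\<exists>L. \<forall>m. of_nat CARD('p) ^ m dvd L - (\<Sum>e<m. of_nat CARD('p) ^ e * t e)"
proof -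
  define S where "S m = (\<Sum>e<m. of_nat CARD('p) ^ e * t e)" for m
  have "zp_residue (S (Suc n)) (Suc n) mod int CARD('p) ^ n = zp_residue (S n) n" for n
    unfolding zp_residue_Suc
    by (subst power_dvd_diff_iff_zp_residue[symmetric]) (simp add: S_def)
  then have "zp_residue (Abs_zp (\<lambda>n. zp_residue (S n) n) :: 'p zp) = (\<lambda>n. zp_residue (S n) n)"
    by (subst Abs_zp_inverse) (auto simp: zp_residue_range)
  then show ?thesis unfolding S_def[symmetric] power_dvd_diff_iff_zp_residue
    by (intro exI[of _ "Abs_zp (\<lambda>n. zp_residue (S n) n)"]) simp
qed

text \<open>
  An inverse modulo \<open>p\<close> gives \<open>x b = 1 - p t\<close>, and the geometric series inverts the right-hand side.
\<close>

lemma zp_unit: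
  fixes x :: "'p::prime_card zp"
  assumes "\<not> of_nat CARD('p) dvd x"
  shows "x dvd 1"
proof -
  let ?p = "of_nat CARD('p) :: 'p zp"
  have "zp_residue x 1 \<noteq> 0" using assms power_dvd_iff_zp_residue[of 1 x] by simp
  then have "\<not> int CARD('p) dvd zp_residue x 1"
    using zp_residue_range[of x 1] by (auto dest: zdvd_imp_le)
  then have "coprime (zp_residue x 1) (int CARD('p))"
    using prime_card_int[where 'a='p] by (simp add: prime_imp_coprime coprime_commute)
  then obtain b where b: "[zp_residue x 1 * b = 1] (mod int CARD('p))"
    using cong_solve_coprime_int by blast
  let ?b = "of_int b :: 'p zp"
  have "?p dvd 1 - x * ?b"
    using power_dvd_diff_iff_zp_residue[of 1 1 "x * ?b"] b
    by (simp add: zp_residue_mult zp_residue_of_int one_zp.rep_eq mod_simps cong_def)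
  then obtain t where t: "1 - x * ?b = ?p * t" ..
  obtain L where L: "\<And>m. ?p ^ m dvd L - (\<Sum>e<m. ?p ^ e * t ^ e)"
    using zp_complete[of "\<lambda>e. t ^ e"] by auto
  have "x * ?b * L - 1 = 0"
  proof (rule zp_separated)
    fix m
    define T where "T = (\<Sum>e<m. ?p ^ e * t ^ e)"
    have "x * ?b = 1 - ?p * t" using t by (simp add: algebra_simps)
    then have "x * ?b * L - 1 = (1 - ?p * t) * (L - T) + (1 - ?p * t) * T - 1"
      by (simp only: flip: distrib_left) simp
    also have "(1 - ?p * t) * T = 1 - (?p * t) ^ m"
      using one_diff_power_eq[of "?p * t" m] by (simp add: T_def power_mult_distrib)
    finally have "x * ?b * L - 1 = (1 - ?p * t) * (L - T) - ?p ^ m * t ^ m"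
      by (simp add: power_mult_distrib)
    then show "?p ^ m dvd x * ?b * L - 1"
      using L[of m] by (simp add: T_def)
  qed
  then have "1 = x * (?b * L)" by (simp add: mult.assoc)
  then show ?thesis by (rule dvdI)
qed

text \<open>
  The multiples of \<open>p\<close> up to \<open>k\<close> contribute \<open>p ^ (k div p) * fact (k div p)\<close>, and the
  remaining factors are prime to \<open>p\<close>.  This is one step of Legendre's formula.
\<close>

lemma fact_eq_power_mult:
  assumes "prime (p::nat)"
  shows "\<exists>M. fact k = p ^ (k div p) * fact (k div p) * M \<and> \<not> p dvd M"
proof (induction k)
  case 0
  show ?case using assms by (auto intro!: exI[of _ 1])
next
  case (Suc k)
  then obtain M where M: "fact k = p ^ (k div p) * fact (k div p) * M" "\<not> p dvd M" by auto
  show ?case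
  proof (cases "p dvd Suc k")
    case True
    then have "Suc k div p = Suc (k div p)"
      by (simp add: div_Suc mod_eq_0_iff_dvd)
    moreover from this True have "Suc k = p * Suc (k div p)" by (metis dvd_mult_div_cancel)
    then have "fact (Suc k) = p * Suc (k div p) * (fact k :: nat)" by (metis fact_Suc of_nat_id)
    ultimately show ?thesis using M
      by (intro exI[of _ M]) (simp add: algebra_simps)
  next
    case False
    then have "Suc k div p = k div p"
      by (simp add: div_Suc mod_eq_0_iff_dvd)
    then show ?thesis using M False assms
      by (intro exI[of _ "Suc k * M"]) (auto simp: prime_dvd_mult_iff simp del: mult_Suc)
  qed
qed

text \<open>
  Iterating the previous step bounds the valuation of \<open>fact k\<close> by \<open>k / (p - 1) \<le> k / 4\<close>.  Here
  \<open>p \<ge> 5\<close> enters: any bound \<open>c k\<close> with \<open>c < 1/2\<close> would do, but \<open>p = 3\<close> only gives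
  \<open>c = 1/2\<close>.
\<close>

lemma fact_eq_small_power_mult:
  assumes "prime (p::nat)" "p \<ge> 5"
  shows "\<exists>v M. fact k = p ^ v * M \<and> \<not> p dvd M \<and> 4 * v \<le> k"
proof (induction k rule: less_induct)
  case (less k)
  show ?case
  proof (cases "k = 0")
    case True
    then show ?thesis using assms by (auto intro!: exI[of _ 0])
  next
    case False
    then have "k div p < k" using assms by simp
    then obtain v M where v: "fact (k div p) = p ^ v * M" "\<not> p dvd M" "4 * v \<le> k div p"
      using less by blast
    obtain M' where M': "fact k = p ^ (k div p) * fact (k div p) * M'" "\<not> p dvd M'"
      using fact_eq_power_mult[OF assms(1)] by blast
    \<comment> \<open>the two contributions are \<open>q = k div p\<close> and \<open>v \<le> q / 4\<close>, and \<open>4 (q + q / 4) = 5 q \<le> k\<close>\<close>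
    have "5 * (k div p) \<le> p * (k div p)" using assms(2) by simp
    also have "\<dots> \<le> k" by simp
    finally have "4 * (k div p + v) \<le> k" using v(3) by simp
    then show ?thesis using v M' assms(1)
      by (intro exI[of _ "k div p + v"] exI[of _ "M * M'"])
        (simp add: power_add prime_dvd_mult_iff)
  qed
qed

lemma fact_dvd_small_power:
  assumes "CARD('p::prime_card) \<ge> 5"
  shows "\<exists>v. 4 * v \<le> k \<and> (of_nat (fact k) :: 'p zp) dvd of_nat CARD('p) ^ v"
proof -
  obtain v M where v: "fact k = CARD('p) ^ v * M" "\<not> CARD('p) dvd M" "4 * v \<le> k"
    using fact_eq_small_power_mult[OF prime_card assms] by blast
  have "zp_residue (of_nat M :: 'p zp) 1 \<noteq> 0"
    using v(2) by (simp add: zp_residue_of_nat mod_greater_zero_iff_not_dvd flip: of_nat_mod)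
  then have "(of_nat M :: 'p zp) dvd 1"
    using power_dvd_iff_zp_residue[of 1 "of_nat M :: 'p zp"] zp_unit by simp
  then have "(of_nat (fact k) :: 'p zp) dvd of_nat CARD('p) ^ v * 1"
    unfolding v(1) of_nat_mult of_nat_power by (rule mult_dvd_mono[OF dvd_refl])
  then show ?thesis using v(3) by auto
qed

section \<open>The p-adic topology of a finitely generated torsion-free algebra\<close>

context zp_algebra
begin

definition p_multiples :: "nat \<Rightarrow> 's set" where
  "p_multiples m = range (scale (of_nat CARD('p) ^ m))"

lemma p_multiples_0 [simp]: "p_multiples 0 = UNIV"
  by (auto simp: p_multiples_def)

lemma subspace_p_multiples: "subspace (p_multiples m)"
proof (rule subspaceI)
  show "0 \<in> p_multiples m"
    unfolding p_multiples_def by (rule range_eqI[of _ _ 0]) simp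
next
  fix x y assume "x \<in> p_multiples m" "y \<in> p_multiples m"
  then show "x + y \<in> p_multiples m"
    by (auto simp: p_multiples_def simp flip: scale_right_distrib)
next
  fix c x assume "x \<in> p_multiples m"
  then show "scale c x \<in> p_multiples m"
    by (auto simp: p_multiples_def scale_left_commute[of c] simp del: scale_scale)
qed

lemmas zero_p_multiples [simp] = subspace_0[OF subspace_p_multiples]
  and add_p_multiples = subspace_add[OF subspace_p_multiples]
  and diff_p_multiples = subspace_diff[OF subspace_p_multiples]
  and sum_p_multiples = subspace_sum[OF subspace_p_multiples]
  and scale_p_multiples = subspace_scale[OF subspace_p_multiples]

lemma scale_dvd_p_multiples: "of_nat CARD('p) ^ m dvd a \<Longrightarrow> scale a x \<in> p_multiples m"
  by (auto simp: p_multiples_def simp flip: scale_scale elim!: dvdE)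

lemma p_multiples_antimono: "m \<le> n \<Longrightarrow> p_multiples n \<subseteq> p_multiples m"
  by (auto simp: p_multiples_def[of n] intro: scale_dvd_p_multiples le_imp_power_dvd)

lemma scale_mult_right: "x * scale a y = scale a (x * y)"
  by (metis mult.commute scale_mult_left)

lemma mult_p_multiples: "x \<in> p_multiples m \<Longrightarrow> x * y \<in> p_multiples m"
  by (auto simp: p_multiples_def scale_mult_left)

lemma scale_power_p_multiples:
  "x \<in> p_multiples m \<Longrightarrow> scale (of_nat CARD('p) ^ k) x \<in> p_multiples (k + m)"
  by (auto simp: p_multiples_def power_add)

lemma cong_mpoly_eval:
  assumes "\<And>j. x j - y j \<in> p_multiples m"
  shows "mpoly_eval scale x P - mpoly_eval scale y P \<in> p_multiples m"
proof -
  have mult: "a * b - c * d \<in> p_multiples m"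
    if "a - c \<in> p_multiples m" "b - d \<in> p_multiples m" for a b c d
  proof -
    have "a * b - c * d = (a - c) * b + (b - d) * c" by (simp add: algebra_simps)
    with that show ?thesis by (simp add: add_p_multiples mult_p_multiples)
  qed
  have pow: "x j ^ n - y j ^ n \<in> p_multiples m" for j n
    by (induction n) (auto intro!: mult assms)
  have "(\<Prod>i\<in>I. x i ^ e i) - (\<Prod>i\<in>I. y i ^ e i) \<in> p_multiples m" for I e
    by (induction I rule: infinite_finite_induct) (auto intro!: mult pow)
  then show ?thesis unfolding mpoly_eval_def
    by (auto simp flip: sum_subtractf scale_right_diff_distrib intro!: sum_p_multiples scale_p_multiples)
qed

text \<open>
  A generating set \<open>G\<close> of minimal size is a basis.  If a relation had a coefficient that is not
  divisible by \<open>p\<close>, hence a unit, its generator could be dropped.  So \<open>p\<close> divides all coefficients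
  of any relation; torsion-freeness allows to cancel it, and by repetition the coefficients are
  divisible by every power of \<open>p\<close>.
\<close>

lemma torsion_free_imp_free:
  assumes "finitely_generated_module scale" and tf: "torsion_free_module scale"
  shows "\<exists>G. finite G \<and> span G = UNIV \<and> (\<forall>a. (\<Sum>g\<in>G. scale (a g) g) = 0 \<longrightarrow> (\<forall>g\<in>G. a g = 0))"
proof -
  let ?p = "of_nat CARD('p) :: 'p zp"
  have tf: "scale a x = 0 \<longleftrightarrow> a = 0 \<or> x = 0" for a x
    using tf by (auto simp: torsion_free_module_def)
  define gen where "gen G \<longleftrightarrow> finite G \<and> span G = UNIV" for G
  obtain G0 where "gen G0"
    using assms(1) by (auto simp: finitely_generated_module_def gen_def)
  then obtain G where G: "gen G" and min: "\<And>G'. gen G' \<Longrightarrow> card G \<le> card G'"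
    using ex_has_least_nat[of gen G0 card] by blast
  then have fin: "finite G" by (simp add: gen_def)
  have p_dvd: "?p dvd a h" if rel: "(\<Sum>g\<in>G. scale (a g) g) = 0" and h: "h \<in> G" for a h
  proof (rule ccontr)
    assume "\<not> ?p dvd a h"
    then obtain b where b: "1 = a h * b" using zp_unit by (metis dvdE)
    have "(\<Sum>g\<in>G. scale (a g) g) = scale (a h) h + (\<Sum>g\<in>G-{h}. scale (a g) g)"
      using h fin by (simp add: sum.remove)
    then have ah: "scale (a h) h = - (\<Sum>g\<in>G-{h}. scale (a g) g)"
      using rel by (simp add: eq_neg_iff_add_eq_0)
    moreover have "- (\<Sum>g\<in>G-{h}. scale (a g) g) \<in> span (G - {h})"
      by (intro span_neg span_sum span_scale span_base)
    ultimately have "scale (a h) h \<in> span (G - {h})" by simp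
    from span_scale[OF this, of b] have "h \<in> span (G - {h})"
      using b by (simp add: mult.commute)
    then have "G \<subseteq> span (G - {h})" by (auto intro: span_base)
    then have "span (G - {h}) = UNIV"
      using G span_minimal[OF _ subspace_span, of G "G - {h}"] by (auto simp: gen_def)
    then have "gen (G - {h})" using fin by (simp add: gen_def)
    then have "card G \<le> card (G - {h})" by (rule min)
    then show False using fin h card_gt_0_iff[of G] by (auto simp: card_Diff_singleton)
  qed
  have pow_dvd: "\<forall>h\<in>G. ?p ^ m dvd a h" if "(\<Sum>g\<in>G. scale (a g) g) = 0" for a m
    using that
  proof (induction m arbitrary: a)
    case (Suc m)
    have "\<forall>h\<in>G. \<exists>c. a h = ?p * c" using p_dvd[OF Suc.prems] by (auto elim!: dvdE)
    then obtain c where c: "\<And>h. h \<in> G \<Longrightarrow> a h = ?p * c h" by metis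
    have "scale ?p (\<Sum>g\<in>G. scale (c g) g) = 0"
      using Suc.prems c by (simp add: scale_sum_right)
    then have "\<forall>h\<in>G. ?p ^ m dvd c h"
      using Suc.IH of_nat_CARD_neq_0 by (auto simp: tf)
    then show ?case using c by (simp add: mult_dvd_mono)
  qed simp
  show ?thesis using G pow_dvd unfolding gen_def
    by (intro exI[of _ G]) (auto intro!: zp_separated)
qed

lemma finite_generators_combination:
  assumes "finite G" "span G = UNIV"
  shows "\<exists>a. y = (\<Sum>g\<in>G. scale (a g) g)"
proof -
  have "y \<in> range (\<lambda>a. \<Sum>g\<in>G. scale (a g) g)"
    unfolding span_finite[OF assms(1), symmetric] assms(2) by (rule UNIV_I)
  then show ?thesis by blast
qed

text \<open>
  The coordinates of \<open>x\<close> with respect to a basis are divisible by every power of \<open>p\<close>.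
\<close>

lemma p_multiples_separated:
  assumes "finitely_generated_module scale" "torsion_free_module scale"
    and x: "\<And>m. x \<in> p_multiples m"
  shows "x = 0"
proof -
  let ?p = "of_nat CARD('p) :: 'p zp"
  obtain G where fin: "finite G" and gen: "span G = UNIV"
    and indep: "\<And>a. (\<Sum>g\<in>G. scale (a g) g) = 0 \<Longrightarrow> (\<forall>g\<in>G. a g = 0)"
    using torsion_free_imp_free[OF assms(1,2)] by auto
  have span: "\<exists>a. y = (\<Sum>g\<in>G. scale (a g) g)" for y
    by (rule finite_generators_combination[OF fin gen])
  obtain a where a: "x = (\<Sum>g\<in>G. scale (a g) g)" using span by blast
  have "?p ^ m dvd a g" if g: "g \<in> G" for m g
  proof -
    obtain y where "x = scale (?p ^ m) y" using x[of m] by (auto simp: p_multiples_def)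
    then obtain b where "x = scale (?p ^ m) (\<Sum>g\<in>G. scale (b g) g)" using span by metis
    then have "(\<Sum>g\<in>G. scale (a g - ?p ^ m * b g) g) = 0"
      using a by (simp add: scale_left_diff_distrib sum_subtractf scale_sum_right)
    then have "a g - ?p ^ m * b g = 0" using indep[of "\<lambda>g. a g - ?p ^ m * b g"] g by blast
    then show ?thesis by simp
  qed
  then have "\<forall>g\<in>G. a g = 0" by (auto intro: zp_separated)
  then show ?thesis using a by simp
qed

text \<open>
  Expanding the terms in finitely many generators reduces completeness to that of the p-adic
  integers, one coordinate at a time.
\<close>

lemma p_multiples_complete:
  assumes "finitely_generated_module scale"
  shows "\<exists>L. \<forall>m. L - (\<Sum>e<m. scale (of_nat CARD('p) ^ e) (t e)) \<in> p_multiples m"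
proof -
  let ?p = "of_nat CARD('p) :: 'p zp"
  obtain G where fin: "finite G" and gen: "span G = UNIV"
    using assms by (auto simp: finitely_generated_module_def)
  have "\<forall>e. \<exists>a. t e = (\<Sum>g\<in>G. scale (a g) g)"
    using finite_generators_combination[OF fin gen] by blast
  from choice[OF this] obtain a where a: "\<And>e. t e = (\<Sum>g\<in>G. scale (a e g) g)" by blast
  have "\<forall>g. \<exists>A. \<forall>m. ?p ^ m dvd A - (\<Sum>e<m. ?p ^ e * a e g)"
    by (intro allI zp_complete)
  from choice[OF this] obtain A where A: "\<And>g m. ?p ^ m dvd A g - (\<Sum>e<m. ?p ^ e * a e g)"
    by blast
  have "(\<Sum>g\<in>G. scale (A g) g) - (\<Sum>e<m. scale (?p ^ e) (t e)) \<in> p_multiples m" for m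
  proof -
    have "(\<Sum>e<m. scale (?p ^ e) (t e)) = (\<Sum>g\<in>G. scale (\<Sum>e<m. ?p ^ e * a e g) g)"
      unfolding a scale_sum_right scale_sum_left scale_scale by (rule sum.swap)
    then show ?thesis
      by (auto simp flip: sum_subtractf scale_left_diff_distrib
          intro!: sum_p_multiples scale_dvd_p_multiples A)
  qed
  then show ?thesis by blast
qed

text \<open>
  A series whose \<open>k\<close>-th term is divisible by \<open>p ^ (k div q)\<close> converges, by grouping its terms into
  blocks of length \<open>q\<close>.  The explicit rate, uniform in everything else, is what later permits the
  interchange of limits by working modulo a fixed power of \<open>p\<close>.
\<close>

lemma summable_of_p_multiples:
  assumes "finitely_generated_module scale" and q: "q > 0" and c: "\<And>k. c k \<in> p_multiples (k div q)"
  shows "\<exists>L. \<forall>m N. N \<ge> q * m \<longrightarrow> L - (\<Sum>k<N. c k) \<in> p_multiples m"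
proof -
  obtain c' where c': "\<And>k. c k = scale (of_nat CARD('p) ^ (k div q)) (c' k)"
    using c unfolding p_multiples_def image_iff by metis
  obtain L where L: "\<And>m. L - (\<Sum>e<m. scale (of_nat CARD('p) ^ e) (\<Sum>r<q. c' (q * e + r))) \<in> p_multiples m"
    using p_multiples_complete[OF assms(1)] by meson
  have block: "(\<Sum>e<m. scale (of_nat CARD('p) ^ e) (\<Sum>r<q. c' (q * e + r))) = (\<Sum>k<q * m. c k)" for m
  proof (induction m)
    case (Suc m)
    have "(\<Sum>k<q * Suc m. c k) = (\<Sum>k<q * m. c k) + (\<Sum>k=q*m..<q*m+q. c k)"
      by (simp add: lessThan_atLeast0 sum.atLeastLessThan_concat add.commute)
    also have "(\<Sum>k=q*m..<q*m+q. c k) = (\<Sum>r<q. c (q * m + r))"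
      using sum.shift_bounds_nat_ivl[of c 0 "q * m" q] by (simp add: lessThan_atLeast0 add.commute)
    also have "\<dots> = scale (of_nat CARD('p) ^ m) (\<Sum>r<q. c' (q * m + r))"
      using q by (simp add: c' scale_sum_right)
    finally show ?case using Suc by simp
  qed simp
  have "L - (\<Sum>k<N. c k) \<in> p_multiples m" if "N \<ge> q * m" for m N
  proof -
    have "(\<Sum>k<N. c k) = (\<Sum>k<q * m. c k) + (\<Sum>k=q*m..<N. c k)"
      using that by (simp add: lessThan_atLeast0 sum.atLeastLessThan_concat)
    then have split: "L - (\<Sum>k<N. c k) = (L - (\<Sum>k<q * m. c k)) - (\<Sum>k=q*m..<N. c k)" by simp
    have "c k \<in> p_multiples m" if "k \<ge> q * m" for k
      using c[of k] that q p_multiples_antimono[of m "k div q"] by (auto simp: less_eq_div_iff_mult_less_eq mult.commute)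
    then have "(\<Sum>k=q*m..<N. c k) \<in> p_multiples m" by (intro sum_p_multiples) auto
    then show ?thesis
      unfolding split by (rule diff_p_multiples[OF L[of m, unfolded block]])
  qed
  then show ?thesis by blast
qed

section \<open>Iterated differences along an orbit\<close>

definition fdiff :: "(nat \<Rightarrow> 's) \<Rightarrow> nat \<Rightarrow> 's" where
  "fdiff f = (\<lambda>n. f (Suc n) - f n)"

lemma newton_forward_difference:
  "f n = (\<Sum>k\<le>n. scale (of_nat (n choose k)) ((fdiff ^^ k) f 0))"
proof (induction n arbitrary: f)
  case (Suc n)
  have "f (Suc n) = f n + fdiff f n" by (simp add: fdiff_def)
  also have "f n = (\<Sum>k\<le>Suc n. scale (of_nat (n choose k)) ((fdiff ^^ k) f 0))"
    using Suc[of f] by (simp add: binomial_eq_0)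
  also have "\<dots> = f 0 + (\<Sum>k\<le>n. scale (of_nat (n choose Suc k)) ((fdiff ^^ Suc k) f 0))"
    by (subst sum.atMost_Suc_shift) simp
  also have "fdiff f n = (\<Sum>k\<le>n. scale (of_nat (n choose k)) ((fdiff ^^ Suc k) f 0))"
    using Suc[of "fdiff f"] by (simp add: funpow_Suc_right del: funpow.simps)
  finally have "f (Suc n) = f 0 + (\<Sum>k\<le>n. scale (of_nat (Suc n choose Suc k)) ((fdiff ^^ Suc k) f 0))"
    by (simp add: scale_left_distrib sum.distrib algebra_simps del: funpow.simps)
  also have "\<dots> = (\<Sum>k\<le>Suc n. scale (of_nat (Suc n choose k)) ((fdiff ^^ k) f 0))"
    by (subst sum.atMost_Suc_shift) simp
  finally show ?case .
qed simp

text \<open>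
  The predicate \<open>weight u k\<close> describes the \<open>k\<close>-th step of a filtration of the ring of sequences
  in \<open>S\<close>: the span over \<open>S\<close> of all products of \<open>p ^ a\<close> with \<open>m\<close> of the sequences \<open>u i\<close> such
  that \<open>2 a + m \<ge> k\<close>.  So \<open>p\<close> counts twice as much as a \<open>u i\<close>; it is under
  this normalisation that differences along the orbit raise the weight by one.
\<close>

inductive weight :: "('d \<Rightarrow> nat \<Rightarrow> 's) \<Rightarrow> nat \<Rightarrow> (nat \<Rightarrow> 's) \<Rightarrow> bool" for u where
  const: "weight u 0 (\<lambda>_. c)"
| zero: "weight u k (\<lambda>_. 0)"
| add: "weight u k f \<Longrightarrow> weight u k g \<Longrightarrow> weight u k (\<lambda>n. f n + g n)"
| p_mult: "weight u k f \<Longrightarrow> weight u (Suc (Suc k)) (\<lambda>n. scale (of_nat CARD('p)) (f n))"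
| gen_mult: "weight u k f \<Longrightarrow> weight u (Suc k) (\<lambda>n. u i n * f n)"
| weaken: "weight u (Suc k) f \<Longrightarrow> weight u k f"

lemma weight_antimono: "weight u k f \<Longrightarrow> j \<le> k \<Longrightarrow> weight u j f"
proof (induction "k - j" arbitrary: j)
  case (Suc d)
  then have "weight u (Suc j) f" by simp
  then show ?case by (rule weight.weaken)
qed simp

lemma weight_const_mult: "weight u k f \<Longrightarrow> weight u k (\<lambda>n. c * f n)"
proof (induction rule: weight.induct)
  case (const c')
  show ?case by (rule weight.const)
next
  case (zero k)
  show ?case by (simp add: weight.zero)
next
  case (add k f g)
  then show ?case by (simp add: distrib_left weight.add)
next
  case (p_mult k f)
  then show ?case by (simp add: scale_mult_right weight.p_mult)
next
  case (gen_mult k f i)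
  show ?case using weight.gen_mult[OF gen_mult.IH] by (simp add: mult.left_commute)
next
  case (weaken k f)
  then show ?case by (blast intro: weight.weaken)
qed

lemma weight_mult:
  assumes "weight u j f" "weight u k g"
  shows "weight u (j + k) (\<lambda>n. f n * g n)"
  using assms(1)
proof (induction rule: weight.induct)
  case (const c)
  show ?case using assms(2) by (simp add: weight_const_mult)
next
  case (zero j)
  show ?case by (simp add: weight.zero)
next
  case (add j f g)
  then show ?case by (simp add: distrib_right weight.add)
next
  case (p_mult j f)
  then show ?case by (simp add: scale_mult_left weight.p_mult)
next
  case (gen_mult j f i)
  show ?case using weight.gen_mult[OF gen_mult.IH] by (simp add: mult.assoc)
next
  case (weaken j f)
  then show ?case by (simp add: weight.weaken)
qed

lemma weight_sum: "(\<And>i. i \<in> I \<Longrightarrow> weight u k (f i)) \<Longrightarrow> weight u k (\<lambda>n. \<Sum>i\<in>I. f i n)"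
  by (induction I rule: infinite_finite_induct) (auto intro: weight.zero weight.add)

lemma weight_gen: "weight u 1 (u i)"
  using weight.gen_mult[OF weight.const[of u 1], of i] by simp

lemma weight_const_p_multiples:
  assumes "x \<in> p_multiples 1"
  shows "weight u 2 (\<lambda>_. x)"
proof -
  obtain y where "x = scale (of_nat CARD('p)) y" using assms by (auto simp: p_multiples_def)
  then show ?thesis using weight.p_mult[OF weight.const[of u y]] by (simp add: numeral_2_eq_2)
qed

text \<open>
  The difference operator obeys the twisted Leibniz rule
  \<open>\<Delta>(u f) = \<Delta>u f + \<Delta>u \<Delta>f + u \<Delta>f\<close>, so it raises all weights by one as soon as it does so
  for the generators.
\<close>

lemma weight_fdiff:
  assumes u: "\<And>i. weight u 2 (fdiff (u i))" and "weight u k f"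
  shows "weight u (Suc k) (fdiff f)"
  using assms(2)
proof (induction rule: weight.induct)
  case (const c)
  show ?case by (simp add: fdiff_def weight.zero)
next
  case (zero k)
  show ?case by (simp add: fdiff_def weight.zero)
next
  case (add k f g)
  then show ?case using weight.add[OF add.IH] by (simp add: fdiff_def algebra_simps)
next
  case (p_mult k f)
  then show ?case using weight.p_mult[OF p_mult.IH] by (simp add: fdiff_def scale_right_diff_distrib)
next
  case (gen_mult k f i)
  have "weight u (Suc (Suc k)) (\<lambda>n. fdiff (u i) n * f n)"
    using weight_mult[OF u gen_mult.hyps] by simp
  moreover have "weight u (Suc (Suc k)) (\<lambda>n. fdiff (u i) n * fdiff f n)"
    using weight_mult[OF u gen_mult.IH] by (simp add: weight.weaken)
  moreover have "weight u (Suc (Suc k)) (\<lambda>n. u i n * fdiff f n)"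
    by (rule weight.gen_mult[OF gen_mult.IH])
  ultimately have "weight u (Suc (Suc k))
      (\<lambda>n. fdiff (u i) n * f n + fdiff (u i) n * fdiff f n + u i n * fdiff f n)"
    by (intro weight.add)
  moreover have "fdiff (\<lambda>n. u i n * f n) =
      (\<lambda>n. fdiff (u i) n * f n + fdiff (u i) n * fdiff f n + u i n * fdiff f n)"
    by (simp add: fdiff_def fun_eq_iff algebra_simps)
  ultimately show ?case by simp
next
  case (weaken k f)
  then show ?case by (blast intro: weight.weaken)
qed

text \<open>
  When all \<open>u i\<close> vanish at \<open>0\<close>, only the products with \<open>m = 0\<close> survive there, and these carry the
  factor \<open>p ^ a\<close> with \<open>2 a \<ge> k\<close>.
\<close>

lemma weight_at_0:
  assumes u: "\<And>i. u i 0 = 0" and "weight u k f"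
  shows "f 0 \<in> p_multiples (Suc k div 2)"
  using assms(2)
proof (induction rule: weight.induct)
  case (p_mult k f)
  then show ?case using scale_power_p_multiples[of "f 0" "Suc k div 2" 1] by simp
next
  case (weaken k f)
  have "Suc k div 2 \<le> Suc (Suc k) div 2" by (rule div_le_mono) simp
  with weaken show ?case using p_multiples_antimono by blast
qed (auto simp: u add_p_multiples)

text \<open>
  First-order Taylor expansion \<open>f = a + (\<Sum>j. b j u j) + \<dots>\<close>, with an error of weight \<open>2\<close>.  It is
  stable under the ring operations, with \<open>b\<close> behaving like a derivation.  This gives Taylor's formula for
  polynomials with the formal partial derivatives, and no factorials in the denominators.
\<close>

definition linear_approx ::
    "('d::finite \<Rightarrow> nat \<Rightarrow> 's) \<Rightarrow> (nat \<Rightarrow> 's) \<Rightarrow> 's \<Rightarrow> ('d \<Rightarrow> 's) \<Rightarrow> bool" where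
  "linear_approx u f a b \<longleftrightarrow> weight u 2 (\<lambda>n. f n - a - (\<Sum>j\<in>UNIV. b j * u j n))"

lemma weight_linear: "weight u 1 (\<lambda>n. \<Sum>j\<in>UNIV. b j * u j n)"
  by (intro weight_sum weight_const_mult weight_gen)

lemma linear_approx_const: "linear_approx u (\<lambda>_. a) a (\<lambda>_. 0)"
  by (simp add: linear_approx_def weight.zero)

lemma linear_approx_gen: "linear_approx u (\<lambda>n. a + u i n) a (\<lambda>j. if j = i then 1 else 0)"
  by (simp add: linear_approx_def weight.zero if_distrib[of "\<lambda>x. x * _"] cong: if_cong)

lemma linear_approx_add:
  assumes "linear_approx u f a b" "linear_approx u f' a' b'"
  shows "linear_approx u (\<lambda>n. f n + f' n) (a + a') (\<lambda>j. b j + b' j)"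
  using weight.add[OF assms[unfolded linear_approx_def]]
  by (simp add: linear_approx_def algebra_simps sum.distrib)

lemma linear_approx_mult:
  assumes "linear_approx u f a b" "linear_approx u f' a' b'"
  shows "linear_approx u (\<lambda>n. f n * f' n) (a * a') (\<lambda>j. a * b' j + a' * b j)"
proof -
  define B B' where "B n = (\<Sum>j\<in>UNIV. b j * u j n)" and "B' n = (\<Sum>j\<in>UNIV. b' j * u j n)" for n
  define r r' where "r n = f n - a - B n" and "r' n = f' n - a' - B' n" for n
  have B: "weight u 1 B" "weight u 1 B'"
    unfolding B_def B'_def by (rule weight_linear)+
  have r: "weight u 2 r" "weight u 2 r'"
    using assms by (simp_all add: linear_approx_def r_def[abs_def] r'_def[abs_def] B_def B'_def)
  have 0: "weight u 0 (\<lambda>n. a + B n)" "weight u 0 (\<lambda>n. a' + B' n + r' n)"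
    using B r by (auto intro!: weight.add weight.const intro: weight_antimono)
  have "weight u 2 (\<lambda>n. r n * (a' + B' n + r' n) + (a + B n) * r' n + B n * B' n)"
    using weight_mult[OF r(1) 0(2)] weight_mult[OF 0(1) r(2)] weight_mult[OF B]
    by (intro weight.add) (simp_all add: numeral_2_eq_2)
  moreover have "r n * (a' + B' n + r' n) + (a + B n) * r' n + B n * B' n =
      f n * f' n - a * a' - (\<Sum>j\<in>UNIV. (a * b' j + a' * b j) * u j n)" for n
  proof -
    have "(\<Sum>j\<in>UNIV. (a * b' j + a' * b j) * u j n) = a * B' n + a' * B n"
      by (simp add: B_def B'_def sum_distrib_left sum.distrib algebra_simps)
    then show ?thesis by (simp add: r_def r'_def algebra_simps)
  qed
  ultimately show ?thesis by (simp add: linear_approx_def)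
qed

lemma linear_approx_scale:
  assumes "linear_approx u f a b"
  shows "linear_approx u (\<lambda>n. scale c (f n)) (scale c a) (\<lambda>j. scale c (b j))"
  using linear_approx_mult[OF linear_approx_const[of u "scale c 1"] assms]
  by (simp add: scale_mult_left)

lemma linear_approx_sum:
  assumes "\<And>m. m \<in> M \<Longrightarrow> linear_approx u (f m) (a m) (b m)"
  shows "linear_approx u (\<lambda>n. \<Sum>m\<in>M. f m n) (\<Sum>m\<in>M. a m) (\<lambda>j. \<Sum>m\<in>M. b m j)"
  using assms
  by (induction M rule: infinite_finite_induct) (auto intro: linear_approx_const linear_approx_add)

lemma linear_approx_power:
  "linear_approx u (\<lambda>n. (a + u i n) ^ k) (a ^ k) (\<lambda>j. if j = i then scale (of_nat k) (a ^ (k - 1)) else 0)"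
proof (induction k)
  case 0
  show ?case using linear_approx_const[of u 1] by (simp cong: if_cong)
next
  case (Suc k)
  have coeff: "a * (if j = i then scale (of_nat k) (a ^ (k - 1)) else 0) + a ^ k * (if j = i then 1 else 0) =
      (if j = i then scale (of_nat (Suc k)) (a ^ (Suc k - 1)) else 0)" for j
  proof -
    have "scale (of_nat k) (a * a ^ (k - 1)) = scale (of_nat k) (a ^ k)"
      by (cases k) simp_all
    then show ?thesis by (simp add: scale_mult_right scale_left_distrib add.commute)
  qed
  show ?case
    using linear_approx_mult[OF linear_approx_gen[of u a i] Suc] by (simp only: coeff power_Suc)
qed

lemma linear_approx_prod:
  assumes "finite I"
  shows "linear_approx u (\<lambda>n. \<Prod>i\<in>I. (s i + u i n) ^ e i) (\<Prod>i\<in>I. s i ^ e i)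
    (\<lambda>j. if j \<in> I then scale (of_nat (e j)) (s j ^ (e j - 1)) * (\<Prod>i\<in>I-{j}. s i ^ e i) else 0)"
  using assms
proof (induction I rule: finite_induct)
  case empty
  show ?case using linear_approx_const[of u 1] by simp
next
  case (insert l I)
  let ?b = "\<lambda>I j. if j \<in> I then scale (of_nat (e j)) (s j ^ (e j - 1)) * (\<Prod>i\<in>I-{j}. s i ^ e i) else 0"
  have "s l ^ e l * ?b I j + (\<Prod>i\<in>I. s i ^ e i) * (if j = l then scale (of_nat (e l)) (s l ^ (e l - 1)) else 0)
      = ?b (insert l I) j" for j
  proof (cases "j = l")
    case True
    then show ?thesis using insert.hyps by (simp add: mult.commute)
  next
    case False
    then have "insert l I - {j} = insert l (I - {j})" by auto
    then show ?thesis using False insert.hyps by (simp add: mult.left_commute)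
  qed
  then show ?case
    using linear_approx_mult[OF linear_approx_power[of u "s l" l "e l"] insert.IH] insert.hyps
    by simp
qed

lemma mpoly_eval_superset:
  assumes "finite A" "Poly_Mapping.keys P \<subseteq> A"
  shows "mpoly_eval scale x P =
    (\<Sum>m\<in>A. scale (Poly_Mapping.lookup P m) (\<Prod>i\<in>UNIV. x i ^ Poly_Mapping.lookup m i))"
  unfolding mpoly_eval_def using assms
  by (intro sum.mono_neutral_left) (auto simp: in_keys_iff)

lemma mpoly_eval_add: "mpoly_eval scale x (P + Q) = mpoly_eval scale x P + mpoly_eval scale x Q"
proof -
  let ?A = "Poly_Mapping.keys P \<union> Poly_Mapping.keys Q"
  show ?thesis
    using Poly_Mapping.keys_add[of P Q]
    by (simp add: mpoly_eval_superset[of ?A] lookup_add scale_left_distrib sum.distrib)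
qed

lemma mpoly_eval_sum: "mpoly_eval scale x (\<Sum>m\<in>M. P m) = (\<Sum>m\<in>M. mpoly_eval scale x (P m))"
  by (induction M rule: infinite_finite_induct) (auto simp: mpoly_eval_add, auto simp: mpoly_eval_def)

lemma mpoly_eval_single:
  "mpoly_eval scale x (Poly_Mapping.single m c) = scale c (\<Prod>i\<in>UNIV. x i ^ Poly_Mapping.lookup m i)"
  by (subst mpoly_eval_superset[of "{m}"]) auto

lemma linear_approx_mpoly_eval:
  "linear_approx u (\<lambda>n. mpoly_eval scale (\<lambda>i. s i + u i n) P) (mpoly_eval scale s P)
     (\<lambda>j. mpoly_eval scale s (mpoly_partial j P))"
proof -
  have "(\<Prod>i\<in>UNIV. s i ^ Poly_Mapping.lookup (m - Poly_Mapping.single j 1) i) =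
      s j ^ (Poly_Mapping.lookup m j - 1) * (\<Prod>i\<in>UNIV-{j}. s i ^ Poly_Mapping.lookup m i)" for m j
    by (subst prod.remove[of _ j]) (auto simp: lookup_minus lookup_single when_def intro!: arg_cong2[of _ _ _ _ times] prod.cong)
  then have "mpoly_eval scale s (mpoly_partial j P) =
      (\<Sum>m\<in>Poly_Mapping.keys P. scale (Poly_Mapping.lookup P m)
        (scale (of_nat (Poly_Mapping.lookup m j)) (s j ^ (Poly_Mapping.lookup m j - 1))
          * (\<Prod>i\<in>UNIV-{j}. s i ^ Poly_Mapping.lookup m i)))" for j
    by (simp add: mpoly_partial_def mpoly_eval_sum mpoly_eval_single scale_mult_left
        mult.commute[of "of_nat _"])
  moreover have "linear_approx u (\<lambda>n. mpoly_eval scale (\<lambda>i. s i + u i n) P) (mpoly_eval scale s P)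
     (\<lambda>j. \<Sum>m\<in>Poly_Mapping.keys P. scale (Poly_Mapping.lookup P m)
        (scale (of_nat (Poly_Mapping.lookup m j)) (s j ^ (Poly_Mapping.lookup m j - 1))
          * (\<Prod>i\<in>UNIV-{j}. s i ^ Poly_Mapping.lookup m i)))"
    unfolding mpoly_eval_def
  proof (intro linear_approx_sum linear_approx_scale)
    fix m
    show "linear_approx u (\<lambda>n. \<Prod>i\<in>UNIV. (s i + u i n) ^ Poly_Mapping.lookup m i)
      (\<Prod>i\<in>UNIV. s i ^ Poly_Mapping.lookup m i)
      (\<lambda>j. scale (of_nat (Poly_Mapping.lookup m j)) (s j ^ (Poly_Mapping.lookup m j - 1))
          * (\<Prod>i\<in>UNIV-{j}. s i ^ Poly_Mapping.lookup m i))"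
      using linear_approx_prod[of UNIV u s "Poly_Mapping.lookup m"] by simp
  qed
  ultimately show ?thesis by simp
qed

text \<open>
  By Taylor's formula, \<open>\<Delta>(u i)\<close> is \<open>H_i(s) - s_i\<close>, plus the Jacobian matrix minus
  the identity applied to \<open>u\<close>, plus terms of second order.  By the two
  congruences, the first part is divisible by \<open>p\<close> and so has weight \<open>2\<close>, and the second is a linear
  form in \<open>u\<close> with coefficients divisible by \<open>p\<close> and so has weight \<open>3\<close>.
\<close>

lemma fdiff_orbit_weight:
  fixes H :: "'d::finite \<Rightarrow> ('d, 'p zp) mpoly"
  assumes fixed: "\<And>i. cong_p scale (mpoly_eval scale s (H i)) (s i)"
    and jacobian: "\<And>i j. cong_p scale (mpoly_eval scale s (mpoly_partial j (H i))) (if i = j then 1 else 0)"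
    and orbit: "\<And>n i. s i + u i (Suc n) = mpoly_eval scale (\<lambda>j. s j + u j n) (H i)"
  shows "weight u 2 (fdiff (u i))"
proof -
  let ?D = "\<lambda>j. mpoly_eval scale s (mpoly_partial j (H i))"
  let ?r = "\<lambda>n. mpoly_eval scale (\<lambda>j. s j + u j n) (H i) - mpoly_eval scale s (H i) - (\<Sum>j\<in>UNIV. ?D j * u j n)"
  have "weight u 2 ?r"
    using linear_approx_mpoly_eval[of u s "H i"] by (simp add: linear_approx_def)
  moreover have "weight u 2 (\<lambda>_. mpoly_eval scale s (H i) - s i)"
    using fixed[of i] by (intro weight_const_p_multiples) (simp add: cong_p_def p_multiples_def)
  moreover have "weight u 2 (\<lambda>n. \<Sum>j\<in>UNIV. (?D j - (if i = j then 1 else 0)) * u j n)"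
  proof (intro weight_sum)
    fix j
    have "weight u 2 (\<lambda>_. ?D j - (if i = j then 1 else 0))"
      using jacobian[of j i] by (intro weight_const_p_multiples) (simp add: cong_p_def p_multiples_def)
    from weight_mult[OF this weight_gen[of u j]]
    show "weight u 2 (\<lambda>n. (?D j - (if i = j then 1 else 0)) * u j n)"
      by (rule weight_antimono) simp
  qed
  ultimately have "weight u 2 (\<lambda>n. ?r n + (mpoly_eval scale s (H i) - s i) +
      (\<Sum>j\<in>UNIV. (?D j - (if i = j then 1 else 0)) * u j n))"
    by (intro weight.add)
  moreover have "fdiff (u i) n = ?r n + (mpoly_eval scale s (H i) - s i) +
      (\<Sum>j\<in>UNIV. (?D j - (if i = j then 1 else 0)) * u j n)" for n
  proof -
    have "(\<Sum>j\<in>UNIV. (if i = j then 1 else 0) * u j n) = u i n"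
      by (simp add: if_distrib[of "\<lambda>x. x * _"] cong: if_cong)
    moreover have "u i (Suc n) = mpoly_eval scale (\<lambda>j. s j + u j n) (H i) - s i"
      using orbit[of i n] by (simp add: algebra_simps)
    ultimately show ?thesis by (simp add: fdiff_def left_diff_distrib sum_subtractf)
  qed
  ultimately show ?thesis by presburger
qed

end

section \<open>Newton series as power series\<close>

definition falling_poly :: "nat \<Rightarrow> 'a::comm_ring_1 poly" where
  "falling_poly k = (\<Prod>i<k. [:- of_nat i, 1:])"

lemma degree_falling_poly: "Polynomial.degree (falling_poly k :: 'a::comm_ring_1 poly) \<le> k"
proof (induction k)
  case (Suc k)
  have "Polynomial.degree (falling_poly (Suc k) :: 'a poly) \<le>
      Polynomial.degree (falling_poly k :: 'a poly) + Polynomial.degree [:- of_nat k :: 'a, 1:]"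
    by (simp only: falling_poly_def prod.lessThan_Suc Polynomial.degree_mult_le)
  then show ?case using Suc by simp
qed (simp add: falling_poly_def)

lemma poly_falling_poly_of_nat:
  "poly (falling_poly k) (of_nat n :: 'a::comm_ring_1) = of_nat (fact k * (n choose k))"
proof (induction k)
  case (Suc k)
  have "(n choose k) * (n - k) = Suc k * (n choose Suc k)"
    using binomial_absorb_comp[of n k] binomial_absorption[of k n] by (simp only: mult.commute)
  then have fact: "fact k * ((n choose k) * (n - k)) = fact (Suc k) * (n choose Suc k)"
    by (simp add: ac_simps del: mult_Suc)
  have choose: "of_nat (n choose k) * (of_nat n - of_nat k) = (of_nat ((n choose k) * (n - k)) :: 'a)"
    by (cases "k \<le> n") (simp_all add: of_nat_diff binomial_eq_0)
  have "poly (falling_poly (Suc k)) (of_nat n :: 'a) = poly (falling_poly k) (of_nat n) * (of_nat n - of_nat k)"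
    by (simp add: falling_poly_def algebra_simps)
  also have "\<dots> = of_nat (fact k * ((n choose k) * (n - k)))"
    by (simp only: Suc of_nat_mult[of "fact k"] mult.assoc choose)
  finally show ?case by (simp only: fact)
qed (simp add: falling_poly_def)

lemma poly_eq_sum_lessThan:
  fixes P :: "'a::comm_ring_1 poly"
  assumes "Polynomial.degree P < N"
  shows "poly P x = (\<Sum>j<N. Polynomial.coeff P j * x ^ j)"
  unfolding poly_altdef using assms
  by (intro sum.mono_neutral_left) (auto simp: Polynomial.coeff_eq_0 not_le)

context zp_algebra
begin

text \<open>
  The valuation of \<open>a\<close> is at least \<open>(k + 1) / 2\<close>, that of \<open>fact k\<close> at most \<open>k / 4\<close>.  So the
  division by \<open>fact k\<close> takes place inside \<open>S\<close>, with about \<open>k / 4\<close> factors \<open>p\<close> left over.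
\<close>

lemma p_multiples_divide_by_fact:
  assumes p: "CARD('p) \<ge> 5" and a: "a \<in> p_multiples (Suc (Suc k) div 2)"
  shows "\<exists>c \<in> p_multiples (k div 4). a = scale (of_nat (fact k)) c"
proof -
  let ?p = "of_nat CARD('p) :: 'p zp" and ?e = "Suc (Suc k) div 2"
  obtain v w where v: "4 * v \<le> k" and w: "?p ^ v = of_nat (fact k) * w"
    using fact_dvd_small_power[where 'p='p, OF p, of k] by (auto elim!: dvdE)
  obtain y where "a = scale (?p ^ ?e) y" using a by (auto simp: p_multiples_def)
  also have "?p ^ ?e = ?p ^ v * ?p ^ (?e - v)"
    using v by (simp flip: power_add)
  finally have "a = scale (of_nat (fact k)) (scale w (scale (?p ^ (?e - v)) y))"
    by (simp add: w mult.assoc)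
  moreover have "k div 4 \<le> ?e - v" using v by linarith
  then have "scale w (scale (?p ^ (?e - v)) y) \<in> p_multiples (k div 4)"
    by (intro scale_p_multiples scale_dvd_p_multiples le_imp_power_dvd)
  ultimately show ?thesis by blast
qed

text \<open>
  Writing \<open>a k = fact k c k\<close>, the Newton series is the sum of the terms \<open>c k\<close> times the falling
  factorial of degree \<open>k\<close>.  Sorting by powers of \<open>z\<close> gives the coefficients \<open>g j\<close>, which converge because the
  \<open>c k\<close> tend to zero, and which have the same rate of decay because only \<open>k \<ge> j\<close> contributes to \<open>g j\<close>.
  For natural \<open>z\<close> the two double sums agree modulo every power of \<open>p\<close>, where they are finite.
\<close>

lemma newton_series_is_power_series:
  assumes fg: "finitely_generated_module scale" and tf: "torsion_free_module scale"
    and p: "CARD('p) \<ge> 5" and a: "\<And>k. a k \<in> p_multiples (Suc (Suc k) div 2)"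
  shows "\<exists>g F. (\<forall>z m N. N \<ge> 4 * m \<longrightarrow> F z - (\<Sum>j<N. scale (z ^ j) (g j)) \<in> p_multiples m) \<and>
    (\<forall>n. F (of_nat n) = (\<Sum>k\<le>n. scale (of_nat (n choose k)) (a k)))"
proof -
  have "\<forall>k. \<exists>c. c \<in> p_multiples (k div 4) \<and> a k = scale (of_nat (fact k)) c"
    using p_multiples_divide_by_fact[OF p a] by blast
  from choice[OF this] obtain c
    where c: "\<And>k. c k \<in> p_multiples (k div 4)" and ac: "\<And>k. a k = scale (of_nat (fact k)) (c k)"
    by blast
  define C where "C k j = (Polynomial.coeff (falling_poly k) j :: 'p zp)" for k j
  have "\<forall>j. \<exists>g. \<forall>m N. N \<ge> 4 * m \<longrightarrow> g - (\<Sum>k<N. scale (C k j) (c k)) \<in> p_multiples m"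
    by (intro allI summable_of_p_multiples[OF fg] scale_p_multiples c) simp
  from choice[OF this] obtain g
    where g: "\<And>j m N. N \<ge> 4 * m \<Longrightarrow> g j - (\<Sum>k<N. scale (C k j) (c k)) \<in> p_multiples m"
    by blast
  have "g j \<in> p_multiples (j div 4)" for j
  proof -
    have "C k j = 0" if "k < j" for k
      using degree_falling_poly[of k, where 'a="'p zp"] that by (simp add: C_def Polynomial.coeff_eq_0)
    then have "(\<Sum>k<4 * (j div 4). scale (C k j) (c k)) = 0"
      by (intro sum.neutral) auto
    then show ?thesis using g[of "j div 4" "4 * (j div 4)" j] by simp
  qed
  then have "\<forall>z. \<exists>L. \<forall>m N. N \<ge> 4 * m \<longrightarrow> L - (\<Sum>j<N. scale (z ^ j) (g j)) \<in> p_multiples m"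
    by (intro allI summable_of_p_multiples[OF fg] scale_p_multiples) simp
  from choice[OF this] obtain F
    where F: "\<And>z m N. N \<ge> 4 * m \<Longrightarrow> F z - (\<Sum>j<N. scale (z ^ j) (g j)) \<in> p_multiples m"
    by blast
  have "F (of_nat n) = (\<Sum>k\<le>n. scale (of_nat (n choose k)) (a k))" for n
  proof -
    have "F (of_nat n) - (\<Sum>k\<le>n. scale (of_nat (n choose k)) (a k)) \<in> p_multiples m" for m
    proof -
      \<comment> \<open>the bound \<open>4 m\<close> makes all tails vanish modulo \<open>p ^ m\<close>, and \<open>n < N\<close> keeps the whole finite Newton sum\<close>
      define N where "N = max (4 * m) (Suc n)"
      define z where "z = (of_nat n :: 'p zp)"
      have "F z - (\<Sum>j<N. scale (z ^ j) (g j)) \<in> p_multiples m"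
        by (rule F) (simp add: N_def)
      moreover have "(\<Sum>j<N. scale (z ^ j) (g j - (\<Sum>k<N. scale (C k j) (c k)))) \<in> p_multiples m"
        by (intro sum_p_multiples scale_p_multiples g) (simp add: N_def)
      ultimately have "F z - (\<Sum>j<N. scale (z ^ j) (g j)) +
          (\<Sum>j<N. scale (z ^ j) (g j - (\<Sum>k<N. scale (C k j) (c k)))) \<in> p_multiples m"
        by (rule add_p_multiples)
      moreover have "(\<Sum>j<N. scale (z ^ j) (\<Sum>k<N. scale (C k j) (c k))) =
          (\<Sum>k\<le>n. scale (of_nat (n choose k)) (a k))"
      proof -
        have "(\<Sum>j<N. scale (z ^ j) (\<Sum>k<N. scale (C k j) (c k))) =
            (\<Sum>k<N. scale (\<Sum>j<N. C k j * z ^ j) (c k))"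
          unfolding scale_sum_right scale_sum_left scale_scale mult.commute[of "z ^ _"]
          by (rule sum.swap)
        also have "\<dots> = (\<Sum>k<N. scale (of_nat (fact k * (n choose k))) (c k))"
        proof (rule sum.cong[OF HOL.refl], rule arg_cong2[where f = scale, OF _ HOL.refl])
          fix k assume "k \<in> {..<N}"
          then have "Polynomial.degree (falling_poly k :: 'p zp poly) < N"
            using degree_falling_poly[of k, where 'a="'p zp"] by simp
          then show "(\<Sum>j<N. C k j * z ^ j) = of_nat (fact k * (n choose k))"
            by (simp only: C_def z_def poly_falling_poly_of_nat flip: poly_eq_sum_lessThan)
        qed
        also have "\<dots> = (\<Sum>k<N. scale (of_nat (n choose k)) (a k))"
          by (simp add: ac mult.commute)
        also have "\<dots> = (\<Sum>k\<le>n. scale (of_nat (n choose k)) (a k))"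
        proof (rule sum.mono_neutral_right)
          show "\<forall>k\<in>{..<N} - {..n}. scale (of_nat (n choose k)) (a k) = 0"
            by (auto simp: binomial_eq_0)
        qed (auto simp: N_def)
        finally show ?thesis .
      qed
      ultimately show ?thesis
        by (simp add: scale_right_diff_distrib sum_subtractf z_def)
    qed
    then have "F (of_nat n) - (\<Sum>k\<le>n. scale (of_nat (n choose k)) (a k)) = 0"
      by (rule p_multiples_separated[OF fg tf])
    then show ?thesis by simp
  qed
  then show ?thesis using F by blast
qed

text \<open>
  Modulo \<open>p ^ m\<close> the series is a polynomial of degree less than \<open>4 m\<close>, independently of \<open>z\<close>.
\<close>

lemma power_series_continuous:
  assumes F: "\<And>z m N. N \<ge> 4 * m \<Longrightarrow> F z - (\<Sum>j<N. scale (z ^ j) (g j)) \<in> p_multiples m"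
    and z: "of_nat CARD('p) ^ m dvd z - z'"
  shows "F z - F z' \<in> p_multiples m"
proof -
  define S where "S z = (\<Sum>j<4 * m. scale (z ^ j) (g j))" for z
  have "of_nat CARD('p) ^ m dvd z ^ j - z' ^ j" for j
    using z unfolding power_diff_sumr2 by (rule dvd_mult2)
  then have "S z - S z' \<in> p_multiples m"
    by (auto simp: S_def simp flip: sum_subtractf scale_left_diff_distrib
        intro!: sum_p_multiples scale_dvd_p_multiples)
  moreover have "F z - S z \<in> p_multiples m" "F z' - S z' \<in> p_multiples m"
    unfolding S_def by (rule F, simp)+
  ultimately have "F z - S z - (F z' - S z') + (S z - S z') \<in> p_multiples m"
    by (blast intro: add_p_multiples diff_p_multiples)
  then show ?thesis by simp
qed

section \<open>The embedding into the base change\<close>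

lemma embed_closed [simp]: "base_change_embed scale x \<in> carrier (base_change scale)"
  by (simp add: carrier_base_change base_change_embed_def)

lemma embed_0: "base_change_embed scale 0 = \<zero>\<^bsub>base_change scale\<^esub>"
  by (simp add: base_change_embed_def zero_base_change tensor_class_eq_iff tensor_rel.zero)

lemma embed_1: "base_change_embed scale 1 = \<one>\<^bsub>base_change scale\<^esub>"
  by (simp add: base_change_embed_def one_base_change)

lemma embed_add:
  "base_change_embed scale (x + y) = base_change_embed scale x \<oplus>\<^bsub>base_change scale\<^esub> base_change_embed scale y"
  using tensor_rel.add_left[of scale x y 1]
  by (simp add: base_change_embed_def base_change_add tensor_class_eq_iff add_mset_commute)

lemma embed_mult:
  "base_change_embed scale (x * y) = base_change_embed scale x \<otimes>\<^bsub>base_change scale\<^esub> base_change_embed scale y"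
  by (simp add: base_change_embed_def base_change_mult)

lemma embed_scale:
  "base_change_embed scale (scale a x) = to_fract a \<odot>\<^bsub>base_change scale\<^esub> base_change_embed scale x"
  using tensor_rel.balanced[of scale a x 1]
  by (simp add: base_change_embed_def base_change_smult formal_smult_def tensor_class_eq_iff)

lemma embed_diff:
  "base_change_embed scale (x - y) = base_change_embed scale x \<ominus>\<^bsub>base_change scale\<^esub> base_change_embed scale y"
proof -
  interpret T: cring "base_change scale" by (rule cring_base_change)
  have "base_change_embed scale (x - y) \<oplus>\<^bsub>base_change scale\<^esub> base_change_embed scale y = base_change_embed scale x"
    by (simp flip: embed_add)
  then show ?thesis by (metis T.add.inv_solve_right T.minus_eq embed_closed)
qed

lemma embed_sum:
  "base_change_embed scale (\<Sum>i\<in>I. x i) = (\<Oplus>\<^bsub>base_change scale\<^esub> i\<in>I. base_change_embed scale (x i))"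
proof -
  interpret T: cring "base_change scale" by (rule cring_base_change)
  show ?thesis
    by (induction I rule: infinite_finite_induct) (simp_all add: embed_0 embed_add T.add.finprod_infinite)
qed

lemma embed_prod:
  "base_change_embed scale (\<Prod>i\<in>I. x i) = (\<Otimes>\<^bsub>base_change scale\<^esub> i\<in>I. base_change_embed scale (x i))"
proof -
  interpret T: cring "base_change scale" by (rule cring_base_change)
  show ?thesis
    by (induction I rule: infinite_finite_induct) (simp_all add: embed_1 embed_mult)
qed

lemma embed_power:
  "base_change_embed scale (x ^ n) = base_change_embed scale x [^]\<^bsub>base_change scale\<^esub> n"
proof -
  interpret T: cring "base_change scale" by (rule cring_base_change)
  show ?thesis by (induction n) (simp_all add: embed_1 embed_mult T.m_comm)
qed

lemma base_change_eval_embed: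
  "base_change_eval scale (\<lambda>j. base_change_embed scale (v j)) P = base_change_embed scale (mpoly_eval scale v P)"
  by (simp add: base_change_eval_def mpoly_eval_def embed_sum embed_scale embed_prod embed_power)

lemma power_series_sums_embed:
  assumes F: "\<And>m N. N \<ge> 4 * m \<Longrightarrow> F - (\<Sum>j<N. scale (z ^ j) (g j)) \<in> p_multiples m"
  shows "power_series_sums scale (Abs_fps (\<lambda>j. base_change_embed scale (g j))) z (base_change_embed scale F)"
proof -
  have power: "to_fract z ^ j = to_fract (z ^ j)" for j
    by (induction j) simp_all
  have "(\<Sum>j<N. scale (z ^ j) (g j)) - F \<in> range (scale (of_nat CARD('p) ^ m))" if "N \<ge> 4 * m" for m N
    using diff_p_multiples[OF zero_p_multiples F[OF that]] by (simp add: p_multiples_def)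
  then have "\<forall>\<^sub>F N in sequentially. (\<Sum>j<N. scale (z ^ j) (g j)) - F \<in> range (scale (of_nat CARD('p) ^ m))" for m
    by (intro eventually_sequentiallyI[of "4 * m"])
  then show ?thesis
    unfolding power_series_sums_def base_change_tendsto_def power fps_nth_Abs_fps
      embed_scale[symmetric] embed_sum[symmetric] embed_diff[symmetric]
    by (blast intro: embed_closed eventually_mono)
qed

end

section \<open>Interpolation of the orbit\<close>

theorem theorem3p1:
  fixes \<sigma> :: "('d::finite, 'p::prime_card zp) mpoly \<Rightarrow> ('d, 'p zp) mpoly"
    and H :: "'d \<Rightarrow> ('d, 'p zp) mpoly"
    and scale :: "'p zp \<Rightarrow> 's \<Rightarrow> 's::{comm_ring, comm_monoid_mult}"
    and s :: "'d \<Rightarrow> 's"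
  assumes p_ge_5: "CARD('p) \<ge> 5"
    and automorphism: "mpoly_algebra_automorphism \<sigma>"
    and sigma_eq: "\<And>i. \<sigma> (mpoly_var i) = H i"
    and algebra: "zp_algebra scale"
    and finitely_generated: "finitely_generated_module scale"
    and torsion_free: "torsion_free_module scale"
    and fixed_mod_p: "\<And>i. cong_p scale (mpoly_eval scale s (H i)) (s i)"
    and jacobian_mod_p:
      "\<And>i j. cong_p scale (mpoly_eval scale s (mpoly_partial j (H i))) (if i = j then 1 else 0)"
  shows "\<exists>(f :: 'd \<Rightarrow> ('s \<times> 'p qp) multiset set fps)
          (F :: 'd \<Rightarrow> 'p zp \<Rightarrow> ('s \<times> 'p qp) multiset set).
           (\<forall>i n. fps_nth (f i) n \<in> carrier (base_change scale)) \<and>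
           (\<forall>i z. power_series_sums scale (f i) z (F i z)) \<and>
           (\<forall>i z. F i (z + 1) = base_change_eval scale (\<lambda>j. F j z) (H i)) \<and>
           (\<forall>i. F i 0 = base_change_embed scale (s i))"
proof -
  interpret zp_algebra scale by (rule algebra)
  define x where "x n = ((\<lambda>v i. mpoly_eval scale v (H i)) ^^ n) s" for n
  have x_0: "x 0 = s" and x_Suc: "x (Suc n) i = mpoly_eval scale (x n) (H i)" for n i
    by (simp_all add: x_def)
  \<comment> \<open>the deviation of the forward orbit \<open>x\<close> of \<open>s\<close> from its starting point\<close>
  define u where "u i n = x n i - s i" for i n
  have u_0: "u i 0 = 0" for i by (simp add: u_def x_0)
  have u_orbit: "s i + u i (Suc n) = mpoly_eval scale (\<lambda>j. s j + u j n) (H i)" for n i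
    by (simp add: u_def x_Suc)
  have fdiff_u: "weight u 2 (fdiff (u i))" for i
    using fixed_mod_p jacobian_mod_p u_orbit by (rule fdiff_orbit_weight[where H = H])
  have "weight u (Suc k) ((fdiff ^^ k) (u i))" for i k
    using weight_gen[of u i] weight_fdiff[OF fdiff_u] by (induction k) simp_all
  then have "(fdiff ^^ k) (u i) 0 \<in> p_multiples (Suc (Suc k) div 2)" for i k
    using weight_at_0[where u = u, OF u_0] by blast
  then have "\<forall>i. \<exists>g F. (\<forall>z m N. N \<ge> 4 * m \<longrightarrow> F z - (\<Sum>j<N. scale (z ^ j) (g j)) \<in> p_multiples m) \<and>
      (\<forall>n. F (of_nat n) = (\<Sum>k\<le>n. scale (of_nat (n choose k)) ((fdiff ^^ k) (u i) 0)))"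
    by (intro allI newton_series_is_power_series[OF finitely_generated torsion_free p_ge_5])
  then obtain g U
    where U: "\<And>i z m N. N \<ge> 4 * m \<Longrightarrow> U i z - (\<Sum>j<N. scale (z ^ j) (g i j)) \<in> p_multiples m"
      and U_nat: "\<And>i n. U i (of_nat n) = u i n"
    unfolding newton_forward_difference[symmetric] by metis
  \<comment> \<open>\<open>U\<close> interpolates \<open>u\<close>, so the constant \<open>s i\<close> has to be added back\<close>
  define g' where "g' i = (g i)(0 := s i + g i 0)" for i
  define F where "F i z = s i + U i z" for i z
  have F: "F i z - (\<Sum>j<N. scale (z ^ j) (g' i j)) \<in> p_multiples m" if "N \<ge> 4 * m" for i z m N
  proof (cases "N = 0")
    case True
    then show ?thesis using that by simp
  next
    case False
    then obtain N' where "N = Suc N'" using not0_implies_Suc by blast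
    then have "(\<Sum>j<N. scale (z ^ j) (g' i j)) = s i + (\<Sum>j<N. scale (z ^ j) (g i j))"
      by (simp add: sum.lessThan_Suc_shift g'_def add.assoc del: sum.lessThan_Suc)
    then show ?thesis using U[OF that, of i z] by (simp add: F_def)
  qed
  have F_nat: "F i (of_nat n) = x n i" for i n
    by (simp add: F_def U_nat u_def)
  \<comment> \<open>both sides are continuous in \<open>z\<close> and agree on the dense set of natural numbers\<close>
  have shift: "F i (z + 1) = mpoly_eval scale (\<lambda>j. F j z) (H i)" for i z
  proof -
    have "F i (z + 1) - mpoly_eval scale (\<lambda>j. F j z) (H i) \<in> p_multiples m" for m
    proof -
      obtain n where n: "of_nat CARD('p) ^ m dvd z - of_nat n" using of_nat_dense_zp by blast
      have cont: "F i y - F i y' \<in> p_multiples m" if "of_nat CARD('p) ^ m dvd y - y'" for i y y'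
        by (rule power_series_continuous[OF F that])
      have "F i (z + 1) - F i (of_nat (Suc n)) \<in> p_multiples m"
        using n by (intro cont) (simp add: algebra_simps)
      moreover have "mpoly_eval scale (\<lambda>j. F j z) (H i) - mpoly_eval scale (\<lambda>j. F j (of_nat n)) (H i) \<in> p_multiples m"
        by (intro cong_mpoly_eval cont n)
      ultimately have "F i (z + 1) - F i (of_nat (Suc n)) -
          (mpoly_eval scale (\<lambda>j. F j z) (H i) - mpoly_eval scale (\<lambda>j. F j (of_nat n)) (H i)) \<in> p_multiples m"
        by (rule diff_p_multiples)
      then show ?thesis unfolding F_nat by (simp add: x_Suc)
    qed
    then have "F i (z + 1) - mpoly_eval scale (\<lambda>j. F j z) (H i) = 0"
      by (rule p_multiples_separated[OF finitely_generated torsion_free])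
    then show ?thesis by simp
  qed
  have F_0: "F i 0 = s i" for i
    using F_nat[of i 0] by (simp add: x_0)
  show ?thesis
    by (rule exI[of _ "\<lambda>i. Abs_fps (\<lambda>j. base_change_embed scale (g' i j))"],
        rule exI[of _ "\<lambda>i z. base_change_embed scale (F i z)"])
      (simp add: power_series_sums_embed[OF F] base_change_eval_embed shift F_0)
qed

end
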